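(* Let $\mathcal{H}$ be a complex Hilbert space, let $A\in\mathcal{B}(\mathcal{H})$ be normal, let $r\geq 1$ be a real number, and let \[ T=\begin{pmatrix}0&A\\ A&0\end{pmatrix} \] on $\mathcal{H}\oplus\mathcal{H}$. Then \[ w^{2r}(T)=\frac14\left\||A|^{2r}+|A^*|^{2r}\right\|+\frac12\, w\!\left(|A|^r|A^*|^r\right)=\|A\|^{2r}. \]
   Context: $\mathcal{B}(\mathcal{H})$ is the algebra of bounded linear operators on the complex Hilbert space $\mathcal{H}$, and $\|\cdot\|$ is the operator norm. $\mathcal{H}\oplus\mathcal{H}$ is the Hilbert space direct sum, and $T(x\oplus y)=Ay\oplus Ax$. For a bounded operator $S$ on a complex Hilbert space $\mathcal{K}$, the numerical radius is $w(S)=\sup\{|\langle Sx,x\rangle| : x\in\mathcal{K},\ \|x\|=1\}$, and $w^{2r}(S)$ means $(w(S))^{2r}$. $|S|=(S^*S)^{1/2}$, so $|S^*|=(SS^* )^{1/2}$. Real powers of positive operators are taken via the continuous functional calculus. *)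

theory Defs
  imports "HOL-Analysis.Analysis"
begin

section \<open>Complex Hilbert spaces\<close>

class complex_vector = real_vector +
  fixes scaleC :: "complex \<Rightarrow> 'a \<Rightarrow> 'a" (infixr \<open>*\<^sub>C\<close> 75)
  assumes scaleC_add_right: "c *\<^sub>C (x + y) = c *\<^sub>C x + c *\<^sub>C y"
    and scaleC_add_left: "(c + d) *\<^sub>C x = c *\<^sub>C x + d *\<^sub>C x"
    and scaleC_scaleC: "c *\<^sub>C (d *\<^sub>C x) = (c * d) *\<^sub>C x"
    and scaleC_one: "1 *\<^sub>C x = x"
    and scaleR_scaleC: "t *\<^sub>R x = complex_of_real t *\<^sub>C x"

text \<open>
  The complex inner product is linear in its first argument.  Its real part is the inner product
  of the underlying real inner product space, so \<open>cinner x x = (norm x)\<^sup>2\<close>, and positive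
  definiteness as well as the norm, metric and topology are those of the class \<open>real_inner\<close>.
\<close>

class complex_inner = complex_vector + real_inner +
  fixes cinner :: "'a \<Rightarrow> 'a \<Rightarrow> complex"
  assumes cinner_commute: "cinner x y = cnj (cinner y x)"
    and cinner_add_left: "cinner (x + y) z = cinner x z + cinner y z"
    and cinner_scaleC_left: "cinner (c *\<^sub>C x) y = c * cinner x y"
    and inner_eq_Re_cinner: "inner x y = Re (cinner x y)"

class chilbert_space = complex_inner + complete_space

instantiation prod :: (complex_vector, complex_vector) complex_vector
begin

definition scaleC_prod_def: "c *\<^sub>C p = (c *\<^sub>C fst p, c *\<^sub>C snd p)"

instance
  by standard
    (simp_all add: scaleC_prod_def scaleC_add_right scaleC_add_left scaleC_scaleC scaleC_one
      scaleR_prod_def scaleR_scaleC)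

end

instantiation prod :: (complex_inner, complex_inner) complex_inner
begin

definition cinner_prod_def: "cinner p q = cinner (fst p) (fst q) + cinner (snd p) (snd q)"

instance
proof
  fix p q s :: "'a \<times> 'b" and c :: complex
  show "cinner p q = cnj (cinner q p)"
    unfolding cinner_prod_def complex_cnj_add by (metis cinner_commute)
  show "cinner (p + q) s = cinner p s + cinner q s"
    by (simp add: cinner_prod_def cinner_add_left)
  show "cinner (c *\<^sub>C p) q = c * cinner p q"
    by (simp add: cinner_prod_def scaleC_prod_def cinner_scaleC_left distrib_left)
  show "inner p q = Re (cinner p q)"
    by (simp add: cinner_prod_def inner_prod_def inner_eq_Re_cinner)
qed

end

instance prod :: (chilbert_space, chilbert_space) chilbert_space ..


section \<open>Bounded operators\<close>

text \<open>
  The type \<open>'a \<Rightarrow>\<^sub>L 'b\<close> consists of the bounded real-linear maps, normed by the operator norm;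
  the algebra of bounded operators on a complex Hilbert space is its subset \<open>bounded_ops\<close>.
\<close>

definition bounded_ops :: "('a::chilbert_space \<Rightarrow>\<^sub>L 'a) set" where
  "bounded_ops = {A :: 'a \<Rightarrow>\<^sub>L 'a. \<forall>c x. A (c *\<^sub>C x) = c *\<^sub>C A x}"

definition cadjoint :: "('a::chilbert_space \<Rightarrow>\<^sub>L 'a) \<Rightarrow> ('a \<Rightarrow>\<^sub>L 'a)" where
  "cadjoint A = (THE B :: 'a \<Rightarrow>\<^sub>L 'a. \<forall>x y. cinner (A x) y = cinner x (B y))"

definition normal_op :: "('a::chilbert_space \<Rightarrow>\<^sub>L 'a) \<Rightarrow> bool" where
  "normal_op A \<longleftrightarrow> A o\<^sub>L cadjoint A = cadjoint A o\<^sub>L A"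

definition block_op ::
  "('a::chilbert_space \<Rightarrow>\<^sub>L 'a) \<Rightarrow> ('a \<Rightarrow>\<^sub>L 'a) \<Rightarrow> ('a \<Rightarrow>\<^sub>L 'a) \<Rightarrow> ('a \<Rightarrow>\<^sub>L 'a) \<Rightarrow> (('a \<times> 'a) \<Rightarrow>\<^sub>L ('a \<times> 'a))" where
  "block_op A B C D = Blinfun (\<lambda>(x, y). (A x + B y, C x + D y))"

lemma block_op_apply: "block_op A B C D (x, y) = (A x + B y, C x + D y)"
proof -
  have "bounded_linear (\<lambda>p. (A (fst p) + B (snd p), C (fst p) + D (snd p)))"
    by (intro bounded_linear_Pair bounded_linear_add bounded_linear_fst bounded_linear_snd
        bounded_linear_compose[OF blinfun.bounded_linear_right])
  then show ?thesis
    by (simp add: block_op_def case_prod_beta' bounded_linear_Blinfun_apply)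
qed

text \<open>
  Inserting \<open>0\<close> means that the supremum is taken among the nonnegative reals.  It only matters on
  the zero space, which has no unit vectors: there the numerical radius is \<open>0\<close>.
\<close>

definition numerical_radius :: "('a::chilbert_space \<Rightarrow>\<^sub>L 'a) \<Rightarrow> real" where
  "numerical_radius S = Sup (insert 0 {cmod (cinner (S x) x) | x. norm x = 1})"


section \<open>Continuous functional calculus\<close>

definition spectrum :: "('a::chilbert_space \<Rightarrow>\<^sub>L 'a) \<Rightarrow> complex set" where
  "spectrum S = {z. \<not> (\<exists>B :: 'a \<Rightarrow>\<^sub>L 'a. B \<in> bounded_ops \<and>
     (\<forall>x. S (B x) - z *\<^sub>C B x = x \<and> B (S x - z *\<^sub>C x) = x))}"

text \<open>
  \<open>\<Phi>\<close> is a contractive unital *-homomorphism from the continuous functions on the spectrum of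
  \<open>S\<close> to the bounded operators, and sends the identity function to \<open>S\<close>.  Functions on the
  spectrum are represented by functions on the whole plane; by linearity and contractivity,
  \<open>\<Phi> f\<close> depends only on the restriction of \<open>f\<close> to the spectrum.  The condition \<open>0 \<le> M\<close> only
  matters on the zero space, where the spectrum is empty.
\<close>

definition is_cfc ::
  "('a::chilbert_space \<Rightarrow>\<^sub>L 'a) \<Rightarrow> ((complex \<Rightarrow> complex) \<Rightarrow> ('a \<Rightarrow>\<^sub>L 'a)) \<Rightarrow> bool" where
  "is_cfc S \<Phi> \<longleftrightarrow>
     \<Phi> (\<lambda>z. 1) = id_blinfun \<and>
     \<Phi> (\<lambda>z. z) = S \<and>
     (\<forall>f. continuous_on (spectrum S) f \<longrightarrow>
        \<Phi> f \<in> bounded_ops \<and>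
        \<Phi> (\<lambda>z. cnj (f z)) = cadjoint (\<Phi> f) \<and>
        (\<forall>c x. \<Phi> (\<lambda>z. c * f z) x = c *\<^sub>C \<Phi> f x) \<and>
        (\<forall>M\<ge>0. (\<forall>z\<in>spectrum S. cmod (f z) \<le> M) \<longrightarrow> norm (\<Phi> f) \<le> M)) \<and>
     (\<forall>f g. continuous_on (spectrum S) f \<and> continuous_on (spectrum S) g \<longrightarrow>
        \<Phi> (\<lambda>z. f z + g z) = \<Phi> f + \<Phi> g \<and>
        \<Phi> (\<lambda>z. f z * g z) = \<Phi> f o\<^sub>L \<Phi> g)"

text \<open>Meaningful for normal \<open>S\<close> and \<open>f\<close> continuous on the spectrum of \<open>S\<close>.\<close>

definition cfc :: "('a::chilbert_space \<Rightarrow>\<^sub>L 'a) \<Rightarrow> (complex \<Rightarrow> complex) \<Rightarrow> ('a \<Rightarrow>\<^sub>L 'a)" where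
  "cfc S f = (THE B. \<exists>\<Phi>. is_cfc S \<Phi> \<and> B = \<Phi> f)"

text \<open>
  Meaningful for positive \<open>P\<close>, whose spectrum consists of nonnegative reals, and for exponents
  \<open>s > 0\<close>.
\<close>

definition op_powr :: "('a::chilbert_space \<Rightarrow>\<^sub>L 'a) \<Rightarrow> real \<Rightarrow> ('a \<Rightarrow>\<^sub>L 'a)" where
  "op_powr P s = cfc P (\<lambda>z. complex_of_real (Re z powr s))"

definition op_abs :: "('a::chilbert_space \<Rightarrow>\<^sub>L 'a) \<Rightarrow> ('a \<Rightarrow>\<^sub>L 'a)" where
  "op_abs S = op_powr (cadjoint S o\<^sub>L S) (1/2)"

end

theory Submission
  imports Defs "HOL-Computational_Algebra.Fundamental_Theorem_Algebra"
begin

text \<open>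
  For normal \<open>A\<close> the operators \<open>A\<^sup>* A\<close> and \<open>A A\<^sup>*\<close> coincide, so \<open>\<bar>A\<bar>\<close> and \<open>\<bar>A\<^sup>*\<bar>\<close> are one positive
  operator \<open>P\<close>, and \<open>\<parallel>P\<parallel> = \<parallel>A\<parallel>\<close>.  The middle term is therefore
  \<open>\<parallel>P\<^sup>2\<^sup>r\<parallel> / 2 + w(P\<^sup>r P\<^sup>r) / 2\<close> with \<open>P\<^sup>r P\<^sup>r = P\<^sup>2\<^sup>r\<close>.  Everything then follows from two facts: a normal
  operator \<open>B\<close> has \<open>w(B) = \<parallel>B\<parallel>\<close> (\<open>numerical_radius_normal\<close>), which applies to \<open>P\<^sup>2\<^sup>r\<close> and to the
  normal operator \<open>T\<close>, whose norm is \<open>\<parallel>A\<parallel>\<close>; and \<open>\<parallel>P\<^sup>s\<parallel> = \<parallel>P\<parallel>\<^sup>s\<close> for positive \<open>P\<close>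
  (\<open>norm_op_powr\<close>).

  The first fact combines \<open>\<parallel>B\<parallel> \<le> 2 w(B)\<close>, the inequality \<open>w(B\<^sup>2) \<le> w(B)\<^sup>2\<close>, and \<open>\<parallel>B\<^sup>2\<parallel> = \<parallel>B\<parallel>\<^sup>2\<close> for
  normal \<open>B\<close>: applied to \<open>B\<close> raised to the power \<open>n = 2\<^sup>k\<close> they give \<open>\<parallel>B\<parallel>\<^sup>n \<le> 2 w(B)\<^sup>n\<close>, and the
  factor \<open>2\<close> disappears as \<open>k\<close> grows.

  The powers come from the continuous functional calculus, whose existence and uniqueness for a
  self-adjoint \<open>S\<close> is \<open>is_cfc_cfc\<close>.  Its core is the estimate of \<open>\<parallel>p(S)\<parallel>\<close> by the maximum of
  \<open>\<bar>p\<bar>\<close> on the spectrum (\<open>norm_poly_op_le\<close>), after which the Weierstrass theorem extends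
  \<open>p \<mapsto> p(S)\<close> from polynomials to continuous functions.  For the estimate the spectrum is handled as
  the set of approximate eigenvalues: \<open>\<parallel>p(S)\<parallel>\<^sup>2\<close> is an approximate eigenvalue of \<open>p(S)\<^sup>* p(S)\<close>,
  and factoring the polynomial \<open>cnj p \<cdot> p - \<parallel>p(S)\<parallel>\<^sup>2\<close> locates a point of the spectrum at which
  \<open>\<bar>p\<bar>\<close> equals \<open>\<parallel>p(S)\<parallel>\<close>.  Both the adjoint and the inverse of \<open>S - z\<close> are obtained from a
  minimization in the Hilbert space (\<open>variational_principle\<close>).
\<close>

section \<open>Complex inner products\<close>

text \<open>Consequently the space of bounded operators is complete, too.\<close>

instance chilbert_space \<subseteq> banach ..

lemma cinner_add_right: "cinner x (y + z) = cinner x y + cinner x z"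
  by (metis cinner_add_left cinner_commute complex_cnj_add)

lemma cinner_scaleC_right: "cinner x (c *\<^sub>C y) = cnj c * cinner x y"
  by (metis cinner_commute cinner_scaleC_left complex_cnj_mult)

lemma scaleC_minus_one: "(-1) *\<^sub>C x = - x"
  using scaleR_scaleC[of "-1" x] by simp

lemma scaleC_minus_left: "(- c) *\<^sub>C x = - (c *\<^sub>C x)"
  using scaleC_scaleC[of "-1" c x] by (simp add: scaleC_minus_one)

lemma scaleC_diff_left: "(c - d) *\<^sub>C x = c *\<^sub>C x - d *\<^sub>C x"
  using scaleC_add_left[of c "- d" x] by (simp add: scaleC_minus_left)

lemma scaleC_zero_left [simp]: "0 *\<^sub>C x = 0"
  using scaleR_scaleC[of 0 x] by simp

lemma cinner_zero_left [simp]: "cinner 0 y = 0"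
  using cinner_scaleC_left[of 0 0 y] by simp

lemma cinner_zero_right [simp]: "cinner x 0 = 0"
  using cinner_commute[of x 0] by simp

lemma cinner_minus_left: "cinner (- x) y = - cinner x y"
  using cinner_scaleC_left[of "-1" x y] by (simp add: scaleC_minus_one)

lemma cinner_minus_right: "cinner x (- y) = - cinner x y"
  using cinner_scaleC_right[of x "-1" y] by (simp add: scaleC_minus_one)

lemma cinner_diff_left: "cinner (x - y) z = cinner x z - cinner y z"
  using cinner_add_left[of x "- y" z] by (simp add: cinner_minus_left)

lemma cinner_diff_right: "cinner x (y - z) = cinner x y - cinner x z"
  using cinner_add_right[of x y "- z"] by (simp add: cinner_minus_right)

lemma cinner_self: "cinner x x = complex_of_real ((norm x)\<^sup>2)"
proof (rule complex_eqI)
  show "Re (cinner x x) = Re (complex_of_real ((norm x)\<^sup>2))"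
    using inner_eq_Re_cinner[of x x] by (simp add: power2_norm_eq_inner)
  show "Im (cinner x x) = Im (complex_of_real ((norm x)\<^sup>2))"
    using arg_cong[OF cinner_commute[of x x], of Im] by simp
qed

lemma norm_scaleC: "norm (c *\<^sub>C x) = cmod c * norm (x :: 'a::complex_inner)"
proof -
  have "complex_of_real ((norm (c *\<^sub>C x))\<^sup>2) = complex_of_real ((cmod c * norm x)\<^sup>2)"
    unfolding cinner_self[symmetric] cinner_scaleC_left cinner_scaleC_right
    unfolding cinner_self power_mult_distrib of_real_mult complex_norm_square
    by (simp add: mult.assoc)
  then have "(norm (c *\<^sub>C x))\<^sup>2 = (cmod c * norm x)\<^sup>2"
    using of_real_eq_iff by blast
  then show ?thesis
    by (simp add: power2_eq_iff_nonneg)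
qed

text \<open>The imaginary part of the complex inner product is again a real inner product.\<close>

lemma cinner_eq_inner:
  "cinner x y = Complex (inner x y) (inner ((- \<i>) *\<^sub>C x) y)"
  by (simp add: complex_eq_iff inner_eq_Re_cinner cinner_scaleC_left)

lemma cinner_eqI: "x = y" if "\<And>z. cinner z x = cinner z y" for x y :: "'a::complex_inner"
proof -
  have "cinner (x - y) (x - y) = 0"
    by (simp add: cinner_diff_right that)
  then show ?thesis
    by (simp add: cinner_self)
qed

lemma unimodular_rotation:
  obtains c where "cmod c = 1" "c * z = complex_of_real (cmod z)"
proof (cases "z = 0")
  case False
  show ?thesis
  proof
    let ?c = "cnj z / complex_of_real (cmod z)"
    show "cmod ?c = 1" using False by (simp add: norm_divide)
    have "?c * z = (z * cnj z) / complex_of_real (cmod z)"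
      by simp
    also have "\<dots> = complex_of_real (cmod z)"
      unfolding complex_norm_square[symmetric] using False by (simp add: power2_eq_square)
    finally show "?c * z = complex_of_real (cmod z)" .
  qed
qed (auto intro: that[of 1])

lemma cmod_cinner_le: "cmod (cinner x y) \<le> norm x * norm y"
proof -
  obtain c where c: "cmod c = 1" "c * cinner x y = complex_of_real (cmod (cinner x y))"
    by (rule unimodular_rotation)
  have "cmod (cinner x y) = inner (c *\<^sub>C x) y"
    using c by (simp add: inner_eq_Re_cinner cinner_scaleC_left)
  also have "\<dots> \<le> norm (c *\<^sub>C x) * norm y"
    by (rule norm_cauchy_schwarz)
  finally show ?thesis
    by (simp add: norm_scaleC c)
qed

lemma bounded_bilinear_cinner: "bounded_bilinear (cinner :: 'a::complex_inner \<Rightarrow> 'a \<Rightarrow> complex)"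
  by (rule bounded_bilinear.intro)
    (auto simp: cinner_add_left cinner_add_right scaleR_scaleC cinner_scaleC_left
      cinner_scaleC_right scaleR_conv_of_real intro!: exI[of _ 1] cmod_cinner_le)

lemmas tendsto_cinner = bounded_bilinear.tendsto[OF bounded_bilinear_cinner]

text \<open>
  The type of bounded real-linear maps has no complex scalar multiples; composition with
  \<open>cscale c\<close> takes their place.
\<close>

definition cscale :: "complex \<Rightarrow> 'a::chilbert_space \<Rightarrow>\<^sub>L 'a" where
  "cscale c = Blinfun (\<lambda>x. c *\<^sub>C x)"

lemma cscale_apply [simp]: "cscale c x = c *\<^sub>C x"
proof -
  have "bounded_linear (\<lambda>x::'a. c *\<^sub>C x)"
    by (rule bounded_linear_intro[where K = "cmod c"])
      (simp_all add: scaleC_add_right scaleR_scaleC scaleC_scaleC norm_scaleC mult.commute)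
  then show ?thesis
    by (simp add: cscale_def bounded_linear_Blinfun_apply)
qed

lemma scaleC_diff_right: "c *\<^sub>C (x - y) = c *\<^sub>C x - c *\<^sub>C (y :: 'a::chilbert_space)"
  using blinfun.diff_right[of "cscale c" x y] by simp

section \<open>The variational principle and adjoints\<close>

text \<open>
  The functional \<open>J x = \<parallel>T x\<parallel>\<^sup>2 - 2 f x\<close> is bounded below because \<open>T\<close> is, and the
  parallelogram law makes every minimizing sequence a Cauchy sequence; at its limit the derivative
  of \<open>J\<close> vanishes.  With the identity as \<open>T\<close> it is the Riesz representation theorem, and in
  general it solves \<open>T\<^sup>* T x = y\<close>.
\<close>

lemma variational_principle:
  fixes T :: "'a::{real_inner, banach} \<Rightarrow>\<^sub>L 'b::real_inner" and f :: "'a \<Rightarrow>\<^sub>L real"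
  assumes c: "c > 0" and bb: "\<And>x. c * norm x \<le> norm (T x)"
  obtains x where "\<And>v. inner (T x) (T v) = f v"
proof -
  define J where "J = (\<lambda>x. (norm (T x))\<^sup>2 - 2 * f x)"
  have "bdd_below (range J)"
  proof (rule bdd_belowI2)
    fix x
    define s where "s = norm f / c"
    have "f x \<le> norm f * norm x"
      using norm_blinfun[of f x] by simp
    moreover have "(c * norm x)\<^sup>2 \<le> (norm (T x))\<^sup>2"
      using bb c by (intro power_mono) auto
    moreover have "0 \<le> (c * norm x - s)\<^sup>2" by simp
    moreover have "(c * norm x - s)\<^sup>2 = (c * norm x)\<^sup>2 - 2 * (norm f * norm x) + s\<^sup>2"
      using c by (simp add: s_def power2_diff)
    ultimately show "- (s\<^sup>2) \<le> J x"
      unfolding J_def by linarith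
  qed
  define m where "m = Inf (range J)"
  have m_le: "m \<le> J x" for x
    unfolding m_def by (rule cInf_lower) (use \<open>bdd_below (range J)\<close> in auto)
  have "\<exists>x. J x < m + 1 / real (Suc n)" for n
  proof (rule ccontr)
    assume "\<nexists>x. J x < m + 1 / real (Suc n)"
    then have "m + 1 / real (Suc n) \<le> m"
      unfolding m_def by (intro cInf_greatest) (auto simp: not_less)
    then show False by simp
  qed
  then obtain u where u: "\<And>n. J (u n) < m + 1 / real (Suc n)" by metis
  have par: "(c * norm (x - y))\<^sup>2 \<le> 2 * (J x - m) + 2 * (J y - m)" for x y
  proof -
    define z where "z = (1/2) *\<^sub>R (x + y)"
    have "J x + J y = 2 * J z + (norm (T (x - y)))\<^sup>2 / 2"
      unfolding J_def z_def power2_norm_eq_inner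
      by (simp add: blinfun.bilinear_simps inner_simps inner_commute field_simps)
    moreover have "(c * norm (x - y))\<^sup>2 \<le> (norm (T (x - y)))\<^sup>2"
      using bb c by (intro power_mono) auto
    moreover have "2 * m \<le> 2 * J z"
      using m_le[of z] by simp
    ultimately show ?thesis
      by (simp add: field_simps)
  qed
  have "Cauchy u"
  proof (rule metric_CauchyI)
    fix e :: real assume "e > 0"
    then obtain N where N: "1 / real (Suc N) < (c * e)\<^sup>2 / 4"
      using c nat_approx_posE[of "(c * e)\<^sup>2 / 4"] by auto
    have "dist (u i) (u j) < e" if "i \<ge> N" "j \<ge> N" for i j
    proof -
      have "1 / real (Suc i) \<le> 1 / real (Suc N)" "1 / real (Suc j) \<le> 1 / real (Suc N)"
        using that by (auto simp: field_simps)
      then have "J (u i) - m < (c * e)\<^sup>2 / 4" "J (u j) - m < (c * e)\<^sup>2 / 4"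
        using u[of i] u[of j] N by linarith+
      then have "2 * (J (u i) - m) + 2 * (J (u j) - m) < (c * e)\<^sup>2"
        by (simp add: field_simps)
      then have "(c * norm (u i - u j))\<^sup>2 < (c * e)\<^sup>2"
        using par[of "u i" "u j"] by (rule order_le_less_trans[rotated])
      then have "c * norm (u i - u j) < c * e"
        using c \<open>e > 0\<close> by (intro power2_less_imp_less[of _ "c * e"]) auto
      then show ?thesis using c by (simp add: dist_norm)
    qed
    then show "\<exists>M. \<forall>i\<ge>M. \<forall>j\<ge>M. dist (u i) (u j) < e" by blast
  qed
  then obtain x where x: "u \<longlonglongrightarrow> x"
    using Cauchy_convergent_iff convergent_def by blast
  have "(\<lambda>n. J (u n)) \<longlonglongrightarrow> J x"
    unfolding J_def by (intro tendsto_intros x blinfun.tendsto tendsto_const)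
  moreover have "(\<lambda>n. m + 1 / real (Suc n)) \<longlonglongrightarrow> m + 0"
    by (intro tendsto_intros LIMSEQ_Suc[OF lim_1_over_n])
  ultimately have "J x \<le> m"
    using LIMSEQ_le[of "\<lambda>n. J (u n)" "J x" "\<lambda>n. m + 1 / real (Suc n)" m] u less_imp_le by auto
  have "inner (T x) (T v) = f v" for v
  proof -
    define d where "d = inner (T x) (T v) - f v"
    have quad: "0 \<le> t\<^sup>2 * (norm (T v))\<^sup>2 + 2 * t * d" for t :: real
    proof -
      have "J (x + t *\<^sub>R v) = J x + t\<^sup>2 * (norm (T v))\<^sup>2 + 2 * t * d"
        unfolding J_def d_def power2_norm_eq_inner
        by (simp add: blinfun.bilinear_simps inner_simps inner_commute algebra_simps
            power2_eq_square)
      then show ?thesis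
        using m_le[of "x + t *\<^sub>R v"] \<open>J x \<le> m\<close> by linarith
    qed
    show ?thesis
    proof (rule ccontr)
      assume "\<not> ?thesis"
      then have "d \<noteq> 0" by (simp add: d_def)
      define K where "K = (norm (T v))\<^sup>2 + 1"
      have "K > 0" unfolding K_def by (simp add: add_nonneg_pos)
      \<comment> \<open>Were \<open>d \<noteq> 0\<close>, a short step in the direction of \<open>- d v\<close> would make \<open>J\<close> smaller.\<close>
      have "0 \<le> (- d / K)\<^sup>2 * (K - 1) + 2 * (- d / K) * d"
        using quad[of "- d / K"] by (simp add: K_def)
      also have "\<dots> = - (d\<^sup>2 * (K + 1) / K\<^sup>2)"
        using \<open>K > 0\<close> by (simp add: field_simps power2_eq_square)
      finally have "d\<^sup>2 * (K + 1) / K\<^sup>2 \<le> 0" by simp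
      moreover have "d\<^sup>2 * (K + 1) / K\<^sup>2 > 0"
        using \<open>d \<noteq> 0\<close> \<open>K > 0\<close> by (intro divide_pos_pos mult_pos_pos) auto
      ultimately show False by simp
    qed
  qed
  then show ?thesis using that by blast
qed

text \<open>
  A relation, so that an adjoint can be identified by exhibiting it, and so that it is preserved
  by limits, before anything is known about its existence.
\<close>

definition adjoint_pair :: "('a::chilbert_space \<Rightarrow>\<^sub>L 'a) \<Rightarrow> ('a \<Rightarrow>\<^sub>L 'a) \<Rightarrow> bool" where
  "adjoint_pair B C \<longleftrightarrow> (\<forall>x y. cinner (B x) y = cinner x (C y))"

lemma adjoint_pairD: "adjoint_pair B C \<Longrightarrow> cinner (B x) y = cinner x (C y)"
  by (simp add: adjoint_pair_def)

lemma adjoint_pair_innerD: "adjoint_pair B C \<Longrightarrow> inner (B x) y = inner x (C y)"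
  by (simp add: adjoint_pair_def inner_eq_Re_cinner)

lemma adjoint_pair_sym: "adjoint_pair B C \<Longrightarrow> adjoint_pair C B"
  unfolding adjoint_pair_def by (metis cinner_commute)

lemma adjoint_pair_unique: "adjoint_pair B C \<Longrightarrow> adjoint_pair B D \<Longrightarrow> C = D"
  by (metis adjoint_pairD blinfun_eqI cinner_eqI)

lemma cadjoint_eq: "adjoint_pair B C \<Longrightarrow> cadjoint B = C"
  unfolding cadjoint_def
  by (rule the_equality) (auto simp: adjoint_pair_def intro: adjoint_pair_unique)

text \<open>
  Having an adjoint already makes a real-linear map complex-linear; membership in \<open>bounded_ops\<close>
  is therefore free wherever an adjoint is known.
\<close>

lemma adjoint_pair_imp_bounded_ops:
  assumes "adjoint_pair B C"
  shows "B \<in> bounded_ops"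
proof -
  have "cinner z (B (c *\<^sub>C x)) = cinner z (c *\<^sub>C B x)" for c x z
    using adjoint_pairD[OF adjoint_pair_sym[OF assms]]
    by (metis cinner_scaleC_right)
  then show ?thesis
    unfolding bounded_ops_def by (auto intro: cinner_eqI)
qed

lemma adjoint_pair_add:
  "adjoint_pair B C \<Longrightarrow> adjoint_pair B' C' \<Longrightarrow> adjoint_pair (B + B') (C + C')"
  by (simp add: adjoint_pair_def blinfun.add_left cinner_add_left cinner_add_right)

lemma adjoint_pair_compose:
  "adjoint_pair B C \<Longrightarrow> adjoint_pair B' C' \<Longrightarrow> adjoint_pair (B o\<^sub>L B') (C' o\<^sub>L C)"
  by (simp add: adjoint_pair_def)

lemma adjoint_pair_cscale: "adjoint_pair (cscale c) (cscale (cnj c))"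
  by (simp add: adjoint_pair_def cinner_scaleC_left cinner_scaleC_right)

lemma norm_adjoint_eq:
  assumes "adjoint_pair B C"
  shows "norm C = norm B"
proof -
  have le: "norm C \<le> norm B" if BC: "adjoint_pair B C" for B C :: "'a \<Rightarrow>\<^sub>L 'a"
  proof (rule norm_blinfun_bound)
    fix y
    have "(norm (C y))\<^sup>2 = inner (B (C y)) y"
      using adjoint_pair_innerD[OF BC] by (simp add: power2_norm_eq_inner)
    also have "\<dots> \<le> norm (B (C y)) * norm y"
      by (rule norm_cauchy_schwarz)
    also have "\<dots> \<le> norm B * norm (C y) * norm y"
      by (intro mult_right_mono norm_blinfun) auto
    finally have "norm (C y) * norm (C y) \<le> norm (C y) * (norm B * norm y)"
      by (simp add: power2_eq_square mult_ac)
    then show "norm (C y) \<le> norm B * norm y"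
      by (cases "norm (C y) = 0") auto
  qed auto
  show ?thesis
    using le[OF assms] le[OF adjoint_pair_sym[OF assms]] by simp
qed

lemma norm_adjoint_compose_self:
  assumes "adjoint_pair B C"
  shows "norm (C o\<^sub>L B) = (norm B)\<^sup>2"
proof (rule antisym)
  show "norm (C o\<^sub>L B) \<le> (norm B)\<^sup>2"
    using norm_blinfun_compose[of C B] norm_adjoint_eq[OF assms] by (simp add: power2_eq_square)
  have "norm B \<le> sqrt (norm (C o\<^sub>L B))"
  proof (rule norm_blinfun_bound)
    fix x
    have "(norm (B x))\<^sup>2 = inner x ((C o\<^sub>L B) x)"
      using adjoint_pair_innerD[OF assms] by (simp add: power2_norm_eq_inner)
    also have "\<dots> \<le> norm x * norm ((C o\<^sub>L B) x)"
      by (rule norm_cauchy_schwarz)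
    also have "\<dots> \<le> norm x * (norm (C o\<^sub>L B) * norm x)"
      by (intro mult_left_mono norm_blinfun) auto
    finally have "(norm (B x))\<^sup>2 \<le> (sqrt (norm (C o\<^sub>L B)) * norm x)\<^sup>2"
      by (simp add: power2_eq_square[of "norm x"] power_mult_distrib mult_ac)
    then show "norm (B x) \<le> sqrt (norm (C o\<^sub>L B)) * norm x"
      by (rule power2_le_imp_le) auto
  qed auto
  then show "(norm B)\<^sup>2 \<le> norm (C o\<^sub>L B)"
    by (metis norm_ge_zero power_mono real_sqrt_pow2)
qed

text \<open>
  The variational principle represents the real functional \<open>v \<mapsto> inner (A v) y\<close>.  Replacing \<open>v\<close> by
  \<open>-\<i> v\<close> gives the imaginary part; this is where complex linearity of \<open>A\<close> enters.
\<close>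

lemma adjoint_pair_cadjoint:
  fixes A :: "'a::chilbert_space \<Rightarrow>\<^sub>L 'a"
  assumes A: "A \<in> bounded_ops"
  shows "adjoint_pair A (cadjoint A)"
proof -
  have "\<exists>z. \<forall>v. inner (A v) y = inner v z" for y
  proof -
    have "bounded_linear (\<lambda>v. inner (A v) y)"
      by (intro bounded_linear_compose[OF bounded_linear_inner_left] blinfun.bounded_linear_right)
    then have f: "Blinfun (\<lambda>v. inner (A v) y) v = inner (A v) y" for v
      by (rule bounded_linear_Blinfun_apply[THEN fun_cong])
    obtain z where "inner (id_blinfun z) (id_blinfun v) = Blinfun (\<lambda>v. inner (A v) y) v" for v
      by (rule variational_principle[of 1 "id_blinfun :: 'a \<Rightarrow>\<^sub>L 'a"]) auto
    then have "inner (A v) y = inner v z" for v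
      unfolding f by (simp add: inner_commute)
    then show ?thesis by blast
  qed
  then obtain B where B: "\<And>v y. inner (A v) y = inner v (B y)" by metis
  have cB: "cinner (A v) y = cinner v (B y)" for v y
    using A B[of "(- \<i>) *\<^sub>C v" y] B[of v y] unfolding cinner_eq_inner bounded_ops_def by simp
  have "bounded_linear B"
  proof (rule bounded_linear_intro)
    show "B (x + y) = B x + B y" for x y
      by (rule cinner_eqI) (simp add: cB[symmetric] cinner_add_right)
    show "B (t *\<^sub>R x) = t *\<^sub>R B x" for t x
      by (rule cinner_eqI) (simp add: cB[symmetric] scaleR_scaleC cinner_scaleC_right)
    show "norm (B y) \<le> norm y * norm A" for y
    proof -
      have "norm (B y) * norm (B y) = inner (A (B y)) y"
        by (simp add: B power2_norm_eq_inner power2_eq_square[symmetric])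
      also have "\<dots> \<le> norm (A (B y)) * norm y"
        by (rule norm_cauchy_schwarz)
      also have "\<dots> \<le> norm A * norm (B y) * norm y"
        by (intro mult_right_mono norm_blinfun) auto
      finally show ?thesis
        by (cases "norm (B y) = 0") (auto simp: mult_ac)
    qed
  qed
  then have "adjoint_pair A (Blinfun B)"
    by (simp add: adjoint_pair_def cB bounded_linear_Blinfun_apply)
  then show ?thesis
    using cadjoint_eq by metis
qed

section \<open>The spectrum of a self-adjoint operator\<close>

text \<open>
  A number \<open>z\<close> is an approximate eigenvalue of \<open>S\<close> when \<open>S - z\<close> is not bounded below.
\<close>

definition bounded_below_op :: "('a::real_normed_vector \<Rightarrow>\<^sub>L 'b::real_normed_vector) \<Rightarrow> bool" where
  "bounded_below_op B \<longleftrightarrow> (\<exists>c>0. \<forall>x. c * norm x \<le> norm (B x))"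

lemma bounded_below_op_compose:
  assumes "bounded_below_op B" "bounded_below_op C"
  shows "bounded_below_op (B o\<^sub>L C)"
proof -
  obtain b c where b: "b > 0" "\<And>x. b * norm x \<le> norm (B x)"
    and c: "c > 0" "\<And>x. c * norm x \<le> norm (C x)"
    using assms unfolding bounded_below_op_def by metis
  have "b * c * norm x \<le> norm (B (C x))" for x
    using order_trans[OF mult_left_mono[OF c(2)] b(2)] b(1) by (simp add: mult.assoc)
  then show ?thesis
    unfolding bounded_below_op_def using b(1) c(1) by (intro exI[of _ "b * c"]) auto
qed

lemma bounded_below_op_if_not_in_spectrum:
  fixes S :: "'a::chilbert_space \<Rightarrow>\<^sub>L 'a"
  assumes "z \<notin> spectrum S"
  shows "bounded_below_op (S - cscale z)"
proof -
  obtain B :: "'a \<Rightarrow>\<^sub>L 'a" where B: "\<And>x. B (S x - z *\<^sub>C x) = x"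
    using assms unfolding spectrum_def by blast
  have "1 / (norm B + 1) * norm x \<le> norm ((S - cscale z) x)" for x
  proof -
    have "norm x \<le> norm B * norm (S x - z *\<^sub>C x)"
      using norm_blinfun[of B "S x - z *\<^sub>C x"] by (simp add: B)
    also have "\<dots> \<le> (norm B + 1) * norm (S x - z *\<^sub>C x)"
      by (simp add: mult_right_mono)
    finally show ?thesis
      by (simp add: blinfun.diff_left divide_le_eq add_nonneg_pos mult.commute)
  qed
  then show ?thesis
    unfolding bounded_below_op_def
    by (intro exI[of _ "1 / (norm B + 1)"]) (simp add: add_nonneg_pos)
qed

text \<open>
  A self-adjoint \<open>S\<close> satisfies \<open>\<parallel>(S - z) x\<parallel> = \<parallel>(S - cnj z) x\<parallel>\<close>.  Hence, when \<open>L = S - z\<close> is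
  bounded below, so is its adjoint, and the variational principle solves \<open>L L\<^sup>* x = y\<close>; this makes
  \<open>L\<close> onto.  So the spectrum of \<open>S\<close> contains only approximate eigenvalues.
\<close>

lemma not_in_spectrum_if_bounded_below_op:
  assumes S: "adjoint_pair S S" and bb: "bounded_below_op (S - cscale z)"
  shows "z \<notin> spectrum S"
proof -
  define L where "L = S - cscale z"
  define L' where "L' = S - cscale (cnj z)"
  have L [simp]: "L x = S x - z *\<^sub>C x" for x by (simp add: L_def blinfun.diff_left)
  have L' [simp]: "L' x = S x - cnj z *\<^sub>C x" for x by (simp add: L'_def blinfun.diff_left)
  obtain c where c: "c > 0" "\<And>x. c * norm x \<le> norm (L x)"
    using bb unfolding L_def bounded_below_op_def by blast
  have adj: "adjoint_pair L L'"
    using S by (simp add: adjoint_pair_def cinner_diff_left cinner_diff_right cinner_scaleC_left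
        cinner_scaleC_right)
  note adj' = adjoint_pair_sym[OF adj]
  have linL: "L (k *\<^sub>C x) = k *\<^sub>C L x" for k x
    using adjoint_pair_imp_bounded_ops[OF adj] by (auto simp: bounded_ops_def)
  have linS: "S (k *\<^sub>C x) = k *\<^sub>C S x" for k x
    using adjoint_pair_imp_bounded_ops[OF S] by (auto simp: bounded_ops_def)
  have comm: "L (L' x) = L' (L x)" for x
    by (simp add: blinfun.diff_right linS scaleC_diff_right scaleC_scaleC mult.commute)
  have "norm (L' x) = norm (L x)" for x
  proof -
    have "(norm (L' x))\<^sup>2 = inner x (L (L' x))"
      using adjoint_pair_innerD[OF adj', of x "L' x"] unfolding power2_norm_eq_inner .
    also have "\<dots> = (norm (L x))\<^sup>2"
      unfolding comm using adjoint_pair_innerD[OF adj, of x "L x"]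
      unfolding power2_norm_eq_inner by simp
    finally show ?thesis by (simp add: power2_eq_iff_nonneg)
  qed
  then have c': "c * norm x \<le> norm (L' x)" for x
    using c(2) by simp
  have "\<exists>x. L x = y" for y
  proof -
    have bl: "bounded_linear (\<lambda>v. inner y v)"
      by (rule bounded_linear_inner_right)
    obtain x where x: "\<And>v. inner (L' x) (L' v) = inner y v"
      using variational_principle[OF c(1) c', of "Blinfun (\<lambda>v. inner y v)"]
      unfolding bounded_linear_Blinfun_apply[OF bl] by blast
    have "inner (L (L' x) - y) v = 0" for v
      using x[of v] adjoint_pair_innerD[OF adj, of "L' x" v] by (simp only: inner_diff_left)
    then have "L (L' x) = y"
      by (metis inner_eq_zero_iff right_minus_eq)
    then show ?thesis ..
  qed
  then obtain G where G: "\<And>y. L (G y) = y" by metis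
  have inj: "x = y" if "L x = L y" for x y
  proof -
    have "c * norm (x - y) \<le> 0"
      using c(2)[of "x - y"] that unfolding blinfun.diff_right by simp
    then show ?thesis using c(1) by (simp add: mult_le_0_iff)
  qed
  have GL: "G (L x) = x" for x
    by (rule inj) (rule G)
  have "bounded_linear G"
  proof (rule bounded_linear_intro)
    show "G (x + y) = G x + G y" for x y
      by (rule inj) (simp only: blinfun.add_right G)
    show "G (t *\<^sub>R x) = t *\<^sub>R G x" for t x
      by (rule inj) (simp only: blinfun.scaleR_right G)
    show "norm (G y) \<le> norm y * (1 / c)" for y
      using c(2)[of "G y"] c(1) unfolding G by (simp add: field_simps)
  qed
  then have G_apply: "Blinfun G x = G x" for x
    by (simp add: bounded_linear_Blinfun_apply)
  moreover have "G (k *\<^sub>C x) = k *\<^sub>C G x" for k x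
    by (rule inj) (simp only: linL G)
  ultimately have "Blinfun G \<in> bounded_ops"
    by (simp add: bounded_ops_def)
  then show ?thesis
    unfolding spectrum_def using G GL G_apply
    by (auto intro!: exI[of _ "Blinfun G"])
qed

lemma in_spectrum_iff:
  "adjoint_pair S S \<Longrightarrow> z \<in> spectrum S \<longleftrightarrow> \<not> bounded_below_op (S - cscale z)"
  using bounded_below_op_if_not_in_spectrum not_in_spectrum_if_bounded_below_op by blast

lemma cinner_self_adjoint_real:
  assumes "adjoint_pair S S"
  shows "cinner (S x) x = complex_of_real (inner (S x) x)"
proof -
  have "cinner (S x) x = cnj (cinner (S x) x)"
    using adjoint_pairD[OF assms, of x x] cinner_commute[of x "S x"] by simp
  then show ?thesis
    by (simp add: complex_eq_iff inner_eq_Re_cinner)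
qed

lemma bounded_below_opI:
  fixes B :: "'a::chilbert_space \<Rightarrow>\<^sub>L 'a"
  assumes "c > 0" and "\<And>x. c * (norm x)\<^sup>2 \<le> cmod (cinner (B x) x)"
  shows "bounded_below_op B"
  unfolding bounded_below_op_def
proof (intro exI[of _ c] conjI allI)
  fix x
  have "(c * norm x) * norm x \<le> norm (B x) * norm x"
    using order_trans[OF assms(2) cmod_cinner_le] by (simp add: power2_eq_square mult_ac)
  then show "c * norm x \<le> norm (B x)"
    by (cases "x = 0") auto
qed fact

text \<open>
  Since \<open>\<langle>S x, x\<rangle>\<close> is real, \<open>\<langle>(S - z) x, x\<rangle>\<close> has the imaginary part \<open>- Im z \<parallel>x\<parallel>\<^sup>2\<close>.
\<close>

lemma spectrum_self_adjoint_real: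
  assumes S: "adjoint_pair S S" and z: "z \<in> spectrum S"
  shows "z \<in> \<real>"
proof (rule ccontr)
  assume "z \<notin> \<real>"
  then have im: "\<bar>Im z\<bar> > 0" by (simp add: complex_is_Real_iff)
  have "\<bar>Im z\<bar> * (norm x)\<^sup>2 \<le> cmod (cinner ((S - cscale z) x) x)" for x
  proof -
    have "\<bar>Im z\<bar> * (norm x)\<^sup>2 = \<bar>Im (cinner ((S - cscale z) x) x)\<bar>"
      by (simp add: blinfun.diff_left cinner_diff_left cinner_scaleC_left
          cinner_self_adjoint_real[OF S] cinner_self abs_mult flip: of_real_power)
    then show ?thesis using abs_Im_le_cmod by simp
  qed
  then show False
    using bounded_below_opI[OF im] z in_spectrum_iff[OF S] by blast
qed

lemma spectrum_positive_nonneg: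
  assumes S: "adjoint_pair S S" and pos: "\<And>x. inner (S x) x \<ge> 0" and z: "z \<in> spectrum S"
  shows "Re z \<ge> 0"
proof (rule ccontr)
  assume "\<not> Re z \<ge> 0"
  then have neg: "- Re z > 0" by simp
  have "- Re z * (norm x)\<^sup>2 \<le> cmod (cinner ((S - cscale z) x) x)" for x
  proof -
    have "- Re z * (norm x)\<^sup>2 \<le> Re (cinner ((S - cscale z) x) x)"
      using pos[of x]
      by (simp add: blinfun.diff_left cinner_diff_left cinner_scaleC_left
          cinner_self_adjoint_real[OF S] cinner_self flip: of_real_power)
    then show ?thesis using complex_Re_le_cmod order_trans by blast
  qed
  then show False
    using bounded_below_opI[OF neg] z in_spectrum_iff[OF S] by blast
qed

lemma spectrum_cmod_le:
  assumes S: "adjoint_pair S S" and z: "z \<in> spectrum S"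
  shows "cmod z \<le> norm S"
proof (rule ccontr)
  assume "\<not> ?thesis"
  then have "cmod z - norm S > 0" by simp
  moreover have "(cmod z - norm S) * norm x \<le> norm ((S - cscale z) x)" for x
    using norm_triangle_ineq2[of "z *\<^sub>C x" "S x"] norm_blinfun[of S x]
    by (simp add: norm_scaleC left_diff_distrib blinfun.diff_left norm_minus_commute)
  ultimately have "bounded_below_op (S - cscale z)"
    unfolding bounded_below_op_def by blast
  then show False
    using z in_spectrum_iff[OF S] by blast
qed

text \<open>Being bounded below is stable under small perturbations, so the spectrum is closed.\<close>

lemma compact_spectrum:
  assumes S: "adjoint_pair S S"
  shows "compact (spectrum S)"
proof -
  have "open (- spectrum S)"
    unfolding open_contains_ball
  proof
    fix z assume "z \<in> - spectrum S"
    then obtain c where c: "c > 0" "\<And>x. c * norm x \<le> norm ((S - cscale z) x)"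
      using bounded_below_op_if_not_in_spectrum unfolding bounded_below_op_def by blast
    have "w \<notin> spectrum S" if w: "dist z w < c / 2" for w
    proof -
      have "c / 2 * norm x \<le> norm ((S - cscale w) x)" for x
      proof -
        have "(S - cscale w) x = (S - cscale z) x + (z - w) *\<^sub>C x"
          by (simp add: blinfun.diff_left scaleC_diff_left)
        then have "norm ((S - cscale w) x) \<ge> norm ((S - cscale z) x) - cmod (z - w) * norm x"
          using norm_diff_ineq[of "(S - cscale z) x" "(z - w) *\<^sub>C x"] by (simp add: norm_scaleC)
        moreover have "cmod (z - w) * norm x \<le> c / 2 * norm x"
          using w by (intro mult_right_mono) (auto simp: dist_norm)
        ultimately show ?thesis
          using c(2)[of x] by (simp add: field_simps)
      qed
      then have "bounded_below_op (S - cscale w)"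
        unfolding bounded_below_op_def using c(1) by (intro exI[of _ "c / 2"]) auto
      then show ?thesis
        using in_spectrum_iff[OF S] by blast
    qed
    then have "ball z (c / 2) \<subseteq> - spectrum S" by auto
    then show "\<exists>e>0. ball z e \<subseteq> - spectrum S"
      using c(1) by (intro exI[of _ "c / 2"]) auto
  qed
  moreover have "bounded (spectrum S)"
    using spectrum_cmod_le[OF S] by (auto simp: bounded_iff)
  ultimately show ?thesis
    by (simp add: compact_eq_bounded_closed closed_def)
qed

section \<open>Polynomials of an operator\<close>

text \<open>Horner's scheme: the recursion is the one that \<open>poly\<close> satisfies.\<close>

definition poly_op :: "('a::chilbert_space \<Rightarrow>\<^sub>L 'a) \<Rightarrow> complex poly \<Rightarrow> ('a \<Rightarrow>\<^sub>L 'a)" where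
  "poly_op S p = fold_coeffs (\<lambda>a B. cscale a + (S o\<^sub>L B)) p 0"

lemma poly_op_0 [simp]: "poly_op S 0 = 0"
  by (simp add: poly_op_def)

lemma poly_op_pCons [simp]: "poly_op S (pCons a p) = cscale a + (S o\<^sub>L poly_op S p)"
  by (cases "p = 0 \<and> a = 0") (auto simp: poly_op_def intro!: blinfun_eqI)

lemma poly_op_add: "poly_op S (p + q) = poly_op S p + poly_op S q"
proof (rule blinfun_eqI, induction p q rule: poly_induct2)
  case (pCons a p b q)
  then show ?case
    by (simp add: blinfun.bilinear_simps scaleC_add_left)
qed simp

lemma poly_op_smult:
  assumes "S \<in> bounded_ops"
  shows "poly_op S (smult c p) = cscale c o\<^sub>L poly_op S p"
proof (rule blinfun_eqI, induction p)
  case (pCons a p)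
  then show ?case
    using assms by (simp add: blinfun.bilinear_simps scaleC_add_right scaleC_scaleC bounded_ops_def)
qed simp

lemma poly_op_mult:
  assumes "S \<in> bounded_ops"
  shows "poly_op S (p * q) = poly_op S p o\<^sub>L poly_op S q"
proof (rule blinfun_eqI, induction p)
  case (pCons a p)
  then show ?case
    by (simp add: blinfun.bilinear_simps poly_op_add poly_op_smult[OF assms])
qed simp

lemma poly_op_commute:
  assumes "S \<in> bounded_ops"
  shows "poly_op S p o\<^sub>L poly_op S q = poly_op S q o\<^sub>L poly_op S p"
  by (metis assms mult.commute poly_op_mult)

lemma adjoint_pair_poly_op:
  assumes S: "adjoint_pair S S"
  shows "adjoint_pair (poly_op S p) (poly_op S (map_poly cnj p))"
proof (induction p)
  case 0
  then show ?case by (simp add: adjoint_pair_def)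
next
  case (pCons a p)
  have X: "poly_op S [:0, 1:] = S"
    by (rule blinfun_eqI) (simp add: blinfun.add_left scaleC_one)
  have "adjoint_pair (S o\<^sub>L poly_op S p) (poly_op S (map_poly cnj p) o\<^sub>L S)"
    by (rule adjoint_pair_compose[OF S pCons.IH])
  also have "poly_op S (map_poly cnj p) o\<^sub>L S = S o\<^sub>L poly_op S (map_poly cnj p)"
    using poly_op_commute[OF adjoint_pair_imp_bounded_ops[OF S], of "map_poly cnj p" "[:0, 1:]"]
    by (simp only: X)
  finally show ?case
    by (simp add: map_poly_pCons adjoint_pair_add adjoint_pair_cscale)
qed

lemma bounded_below_op_cscale: "c \<noteq> 0 \<Longrightarrow> bounded_below_op (cscale c)"
  unfolding bounded_below_op_def by (intro exI[of _ "cmod c"]) (simp add: norm_scaleC)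

text \<open>
  By the fundamental theorem of algebra \<open>q(S)\<close> is a product of a nonzero scalar and factors
  \<open>S - z\<close>, one for each root \<open>z\<close>; if all of these are bounded below, then so is \<open>q(S)\<close>.
\<close>

lemma root_in_spectrum:
  fixes S :: "'a::chilbert_space \<Rightarrow>\<^sub>L 'a"
  assumes S: "adjoint_pair S S" and "q \<noteq> 0" and "\<not> bounded_below_op (poly_op S q)"
  shows "\<exists>z\<in>spectrum S. poly q z = 0"
  using assms(2,3)
proof (induction "degree q" arbitrary: q)
  case 0
  then obtain c where q: "q = [:c:]" by (metis degree_eq_zeroE)
  have "poly_op S q = cscale c"
    by (rule blinfun_eqI) (simp add: q)
  then show ?case
    using bounded_below_op_cscale[of c, where 'a = 'a] 0 q by simp
next
  case (Suc n)
  have "\<not> constant (poly q)"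
    using Suc.hyps(2) by (simp add: constant_degree)
  then obtain z where z: "poly q z = 0"
    using fundamental_theorem_of_algebra by blast
  then obtain q' where q: "q = [:- z, 1:] * q'"
    using poly_eq_0_iff_dvd by (metis dvdE)
  show ?case
  proof (cases "z \<in> spectrum S")
    case False
    have "poly_op S [:- z, 1:] = S - cscale z"
      by (rule blinfun_eqI)
        (simp add: blinfun.bilinear_simps scaleC_one scaleC_minus_left)
    then have "poly_op S q = (S - cscale z) o\<^sub>L poly_op S q'"
      unfolding q poly_op_mult[OF adjoint_pair_imp_bounded_ops[OF S]] by simp
    then have "\<not> bounded_below_op (poly_op S q')"
      using Suc.prems(2) bounded_below_op_compose bounded_below_op_if_not_in_spectrum[OF False]
      by auto
    moreover have "q' \<noteq> 0" using Suc.prems(1) q by auto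
    moreover have "n = degree q'"
      using Suc.hyps(2) \<open>q' \<noteq> 0\<close> unfolding q by (subst (asm) degree_mult_eq) auto
    ultimately show ?thesis
      using Suc.hyps(1) q by fastforce
  qed (use z in blast)
qed

text \<open>
  Vectors \<open>x\<close> on which \<open>\<parallel>B x\<parallel> / \<parallel>x\<parallel>\<close> comes close to \<open>\<parallel>B\<parallel>\<close> are approximate eigenvectors of
  \<open>B\<^sup>* B\<close> for the value \<open>\<parallel>B\<parallel>\<^sup>2\<close>.
\<close>

lemma norm_square_not_bounded_below:
  fixes B C :: "'a::chilbert_space \<Rightarrow>\<^sub>L 'a" and x0 :: 'a
  assumes adj: "adjoint_pair B C" and x0: "x0 \<noteq> 0"
  shows "\<not> bounded_below_op ((C o\<^sub>L B) - cscale (complex_of_real ((norm B)\<^sup>2)))"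
proof
  define b where "b = norm B"
  assume "bounded_below_op ((C o\<^sub>L B) - cscale (complex_of_real ((norm B)\<^sup>2)))"
  then obtain c where c: "c > 0" and
    bb: "\<And>x. c * norm x \<le> norm (C (B x) - b\<^sup>2 *\<^sub>R x)"
    unfolding bounded_below_op_def b_def
    by (auto simp: blinfun.diff_left scaleR_scaleC)
  have main: "c\<^sup>2 * (norm x)\<^sup>2 \<le> b\<^sup>2 * (b\<^sup>2 * (norm x)\<^sup>2 - (norm (B x))\<^sup>2)" for x
  proof -
    have "norm (C (B x)) \<le> b * norm (B x)"
      using norm_blinfun[of C "B x"] norm_adjoint_eq[OF adj] by (simp add: b_def)
    then have "(norm (C (B x)))\<^sup>2 \<le> b\<^sup>2 * (norm (B x))\<^sup>2"
      by (metis norm_ge_zero power_mono power_mult_distrib)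
    moreover have "(norm (C (B x) - b\<^sup>2 *\<^sub>R x))\<^sup>2
        = (norm (C (B x)))\<^sup>2 - 2 * b\<^sup>2 * (norm (B x))\<^sup>2 + b\<^sup>2 * b\<^sup>2 * (norm x)\<^sup>2"
      using adjoint_pair_innerD[OF adj, of x "B x"]
      unfolding power2_norm_eq_inner by (simp add: inner_simps inner_commute algebra_simps)
    moreover have "(c * norm x)\<^sup>2 \<le> (norm (C (B x) - b\<^sup>2 *\<^sub>R x))\<^sup>2"
      using bb c by (intro power_mono) auto
    ultimately show ?thesis
      by (simp add: power_mult_distrib algebra_simps)
  qed
  have "b \<noteq> 0"
    using main[of x0] c x0 by (auto simp flip: power_mult_distrib)
  have "b > 0"
    using \<open>b \<noteq> 0\<close> by (simp add: b_def)
  define d where "d = b\<^sup>2 - c\<^sup>2 / b\<^sup>2"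
  have le: "(norm (B x))\<^sup>2 \<le> d * (norm x)\<^sup>2" for x
    using main[of x] \<open>b > 0\<close> by (simp add: d_def field_simps)
  have "d \<ge> 0"
    using order_trans[OF zero_le_power2 le[of x0]] x0 by (simp add: zero_le_mult_iff)
  have "norm B \<le> sqrt d"
  proof (rule norm_blinfun_bound)
    fix x
    have "norm (B x) \<le> sqrt (d * (norm x)\<^sup>2)"
      using le by (simp add: real_le_rsqrt)
    then show "norm (B x) \<le> sqrt d * norm x"
      by (simp add: real_sqrt_mult)
  qed (use \<open>d \<ge> 0\<close> in auto)
  then have "b\<^sup>2 \<le> d"
    using \<open>d \<ge> 0\<close> \<open>b > 0\<close> by (metis b_def norm_ge_zero power_mono real_sqrt_pow2)
  then show False
    using c \<open>b > 0\<close> by (simp add: d_def divide_le_0_iff)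
qed

text \<open>
  The value \<open>\<parallel>p(S)\<parallel>\<^sup>2\<close> is an approximate eigenvalue of \<open>p(S)\<^sup>* p(S)\<close>, so the polynomial
  \<open>cnj p \<cdot> p - \<parallel>p(S)\<parallel>\<^sup>2\<close> has a root \<open>z\<close> in the spectrum; it takes the value
  \<open>\<bar>p z\<bar>\<^sup>2 - \<parallel>p(S)\<parallel>\<^sup>2\<close> there since \<open>z\<close> is real.
\<close>

lemma norm_poly_op_attained:
  fixes S :: "'a::chilbert_space \<Rightarrow>\<^sub>L 'a"
  assumes S: "adjoint_pair S S" and x0: "(x0 :: 'a) \<noteq> 0"
  shows "\<exists>z\<in>spectrum S. cmod (poly p z) = norm (poly_op S p)"
proof -
  define Q where "Q = (\<lambda>p. map_poly cnj p * p - [:complex_of_real ((norm (poly_op S p))\<^sup>2):])"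
  have bop: "S \<in> bounded_ops"
    by (rule adjoint_pair_imp_bounded_ops[OF S])
  have not_bb: "\<not> bounded_below_op (poly_op S (Q p))" for p
  proof -
    define b where "b = complex_of_real ((norm (poly_op S p))\<^sup>2)"
    have "poly_op S (Q p) = (poly_op S (map_poly cnj p) o\<^sub>L poly_op S p) - cscale b"
      unfolding Q_def diff_conv_add_uminus poly_op_add poly_op_mult[OF bop] b_def[symmetric]
      by (rule blinfun_eqI) (simp add: blinfun.bilinear_simps scaleC_minus_left)
    then show ?thesis
      using norm_square_not_bounded_below[OF adjoint_pair_poly_op[OF S] x0, of p]
      by (simp add: b_def)
  qed
  have attained: "cmod (poly p z) = norm (poly_op S p)"
    if "z \<in> spectrum S" "poly (Q p) z = 0" for p z
  proof -
    have "cnj z = z"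
      using spectrum_self_adjoint_real[OF S that(1)] by (simp add: Reals_cnj_iff)
    then have "complex_of_real ((cmod (poly p z))\<^sup>2) = complex_of_real ((norm (poly_op S p))\<^sup>2)"
      using that(2) unfolding complex_norm_square Q_def by (simp add: mult.commute)
    then have "(cmod (poly p z))\<^sup>2 = (norm (poly_op S p))\<^sup>2"
      using of_real_eq_iff by blast
    then show ?thesis
      by (simp add: power2_eq_iff_nonneg)
  qed
  show ?thesis
  proof (cases "Q p = 0")
    case False
    then show ?thesis
      using root_in_spectrum[OF S _ not_bb[of p]] attained by blast
  next
    case True
    \<comment> \<open>Here \<open>p\<close> is constant, and any point of the spectrum will do; the polynomial \<open>X\<close> yields one.\<close>
    have "coeff (Q [:0, 1:]) 2 = 1"
      by (simp add: Q_def map_poly_pCons numeral_2_eq_2)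
    then have "Q [:0, 1:] \<noteq> 0" by auto
    then obtain z where "z \<in> spectrum S"
      using root_in_spectrum[OF S _ not_bb] by blast
    then show ?thesis
      using attained True by (intro bexI[of _ z]) simp
  qed
qed

lemma norm_poly_op_le:
  fixes S :: "'a::chilbert_space \<Rightarrow>\<^sub>L 'a"
  assumes S: "adjoint_pair S S" and M: "M \<ge> 0" "\<And>z. z \<in> spectrum S \<Longrightarrow> cmod (poly p z) \<le> M"
  shows "norm (poly_op S p) \<le> M"
proof (cases "\<exists>x0::'a. x0 \<noteq> 0")
  case True
  then show ?thesis
    using norm_poly_op_attained[OF S] M(2) by metis
next
  case False
  then have "poly_op S p = 0"
    by (intro blinfun_eqI) metis
  then show ?thesis using M(1) by simp
qed

section \<open>The continuous functional calculus of a self-adjoint operator\<close>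

lemma real_polynomial_function_is_poly:
  fixes g :: "real \<Rightarrow> real"
  assumes "real_polynomial_function g"
  shows "\<exists>p. \<forall>t. poly p (complex_of_real t) = complex_of_real (g t)"
  using assms
proof induction
  case (linear h)
  have "t * h 1 = h t" for t
    using linear_simps(5)[OF linear, of t 1] by simp
  then show ?case
    by (intro exI[of _ "[:0, complex_of_real (h 1):]"] allI) (simp flip: of_real_mult)
next
  case (const c)
  show ?case by (intro exI[of _ "[:complex_of_real c:]"]) simp
next
  case (add g h)
  then obtain p q where "\<forall>t. poly p (complex_of_real t) = complex_of_real (g t)"
    "\<forall>t. poly q (complex_of_real t) = complex_of_real (h t)" by blast
  then show ?case by (intro exI[of _ "p + q"]) simp
next
  case (mult g h)
  then obtain p q where "\<forall>t. poly p (complex_of_real t) = complex_of_real (g t)"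
    "\<forall>t. poly q (complex_of_real t) = complex_of_real (h t)" by blast
  then show ?case by (intro exI[of _ "p * q"]) simp
qed

lemma Weierstrass_complex_poly:
  fixes f :: "complex \<Rightarrow> complex"
  assumes K: "compact K" "K \<subseteq> \<real>" and f: "continuous_on K f" and e: "e > 0"
  shows "\<exists>p. \<forall>z\<in>K. cmod (f z - poly p z) < e"
proof -
  define L where "L = Re ` K"
  have K_eq: "K = complex_of_real ` L"
    using K(2) by (force simp: L_def image_image complex_is_Real_iff complex_eq_iff)
  have L: "compact L"
    unfolding L_def by (intro compact_continuous_image K continuous_intros)
  have fL: "continuous_on L (\<lambda>t. f (complex_of_real t))"
    by (rule continuous_on_compose2[OF f]) (auto simp: K_eq intro!: continuous_intros)
  have e2: "e / 2 > 0" using e by simp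
  obtain g where g: "real_polynomial_function g"
    "\<And>t. t \<in> L \<Longrightarrow> \<bar>Re (f (complex_of_real t)) - g t\<bar> < e / 2"
    using Stone_Weierstrass_real_polynomial_function[OF L continuous_on_Re[OF fL] e2] by metis
  obtain h where h: "real_polynomial_function h"
    "\<And>t. t \<in> L \<Longrightarrow> \<bar>Im (f (complex_of_real t)) - h t\<bar> < e / 2"
    using Stone_Weierstrass_real_polynomial_function[OF L continuous_on_Im[OF fL] e2] by metis
  obtain p q where p: "\<And>t. poly p (complex_of_real t) = complex_of_real (g t)"
    and q: "\<And>t. poly q (complex_of_real t) = complex_of_real (h t)"
    using real_polynomial_function_is_poly[OF g(1)] real_polynomial_function_is_poly[OF h(1)]
    by blast
  have "cmod (f z - poly (p + smult \<i> q) z) < e" if z: "z \<in> K" for z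
  proof -
    obtain t where t: "t \<in> L" "z = complex_of_real t"
      using z K_eq by blast
    have "cmod (f z - poly (p + smult \<i> q) z) \<le>
        \<bar>Re (f z - poly (p + smult \<i> q) z)\<bar> + \<bar>Im (f z - poly (p + smult \<i> q) z)\<bar>"
      by (rule cmod_le)
    also have "\<dots> < e / 2 + e / 2"
      using g(2)[OF t(1)] h(2)[OF t(1)] by (intro add_strict_mono) (simp_all add: t p q)
    finally show ?thesis by simp
  qed
  then show ?thesis by blast
qed

text \<open>
  The graph of the functional calculus is the closure of the graph of \<open>p \<mapsto> p(S)\<close>, with uniform
  convergence on the spectrum on one side and norm convergence on the other; stated with sequences, every rule of the calculus becomes a limit of the same rule for polynomials.
\<close>

definition cfc_graph ::
  "('a::chilbert_space \<Rightarrow>\<^sub>L 'a) \<Rightarrow> (complex \<Rightarrow> complex) \<Rightarrow> ('a \<Rightarrow>\<^sub>L 'a) \<Rightarrow> bool" where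
  "cfc_graph S f B \<longleftrightarrow> (\<exists>p :: nat \<Rightarrow> complex poly.
     uniform_limit (spectrum S) (\<lambda>n. poly (p n)) f sequentially \<and>
     (\<lambda>n. poly_op S (p n)) \<longlonglongrightarrow> B)"

lemma cfc_graph_poly: "cfc_graph S (poly p) (poly_op S p)"
  unfolding cfc_graph_def by (intro exI[of _ "\<lambda>n. p"]) (auto intro: uniform_limit_const)

context
  fixes S :: "'a::chilbert_space \<Rightarrow>\<^sub>L 'a"
  assumes S: "adjoint_pair S S"
begin

lemma bounded_ops_self_adjoint: "S \<in> bounded_ops"
  by (rule adjoint_pair_imp_bounded_ops[OF S])

lemma cfc_graph_add:
  assumes "cfc_graph S f B" "cfc_graph S g C"
  shows "cfc_graph S (\<lambda>z. f z + g z) (B + C)"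
proof -
  obtain p q where "uniform_limit (spectrum S) (\<lambda>n. poly (p n)) f sequentially"
    "(\<lambda>n. poly_op S (p n)) \<longlonglongrightarrow> B"
    "uniform_limit (spectrum S) (\<lambda>n. poly (q n)) g sequentially"
    "(\<lambda>n. poly_op S (q n)) \<longlonglongrightarrow> C"
    using assms unfolding cfc_graph_def by blast
  then show ?thesis
    unfolding cfc_graph_def
    by (intro exI[of _ "\<lambda>n. p n + q n"])
      (auto simp: poly_op_add poly_add[abs_def] intro!: uniform_limit_add tendsto_add)
qed

lemma cfc_graph_mult:
  assumes f: "cfc_graph S f B" "continuous_on (spectrum S) f"
    and g: "cfc_graph S g C" "continuous_on (spectrum S) g"
  shows "cfc_graph S (\<lambda>z. f z * g z) (B o\<^sub>L C)"
proof -
  obtain p q where p: "uniform_limit (spectrum S) (\<lambda>n. poly (p n)) f sequentially"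
    "(\<lambda>n. poly_op S (p n)) \<longlonglongrightarrow> B"
    and q: "uniform_limit (spectrum S) (\<lambda>n. poly (q n)) g sequentially"
    "(\<lambda>n. poly_op S (q n)) \<longlonglongrightarrow> C"
    using f(1) g(1) unfolding cfc_graph_def by blast
  have bdd: "bounded (h ` spectrum S)" if "continuous_on (spectrum S) h" for h :: "complex \<Rightarrow> complex"
    by (rule compact_imp_bounded[OF compact_continuous_image[OF that compact_spectrum[OF S]]])
  have "uniform_limit (spectrum S) (\<lambda>n. poly (p n * q n)) (\<lambda>z. f z * g z) sequentially"
    unfolding poly_mult by (rule uniform_lim_mult[OF p(1) q(1) bdd[OF f(2)] bdd[OF g(2)]])
  moreover have "(\<lambda>n. poly_op S (p n * q n)) \<longlonglongrightarrow> (B o\<^sub>L C)"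
    unfolding poly_op_mult[OF bounded_ops_self_adjoint]
    by (rule bounded_bilinear.tendsto[OF bounded_bilinear_blinfun_compose p(2) q(2)])
  ultimately show ?thesis
    unfolding cfc_graph_def by (intro exI[of _ "\<lambda>n. p n * q n"] conjI)
qed

lemma cfc_graph_cscale:
  assumes "cfc_graph S f B" "continuous_on (spectrum S) f"
  shows "cfc_graph S (\<lambda>z. c * f z) (cscale c o\<^sub>L B)"
proof -
  have "poly_op S [:c:] = cscale c"
    by (rule blinfun_eqI) simp
  then have "cfc_graph S (\<lambda>z. c) (cscale c)"
    using cfc_graph_poly[of S "[:c:]"] by (simp add: poly_pCons[abs_def])
  then show ?thesis
    using assms by (intro cfc_graph_mult continuous_on_const)
qed

text \<open>
  Conjugating the coefficients of the approximating polynomials passes to the adjoint operators,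
  and it conjugates the values on the spectrum because the spectrum is real.
\<close>

lemma cfc_graph_cnj:
  assumes "cfc_graph S f B"
  shows "\<exists>C. cfc_graph S (\<lambda>z. cnj (f z)) C \<and> adjoint_pair B C"
proof -
  obtain p where p: "uniform_limit (spectrum S) (\<lambda>n. poly (p n)) f sequentially"
    "(\<lambda>n. poly_op S (p n)) \<longlonglongrightarrow> B"
    using assms unfolding cfc_graph_def by blast
  define p' where "p' = (\<lambda>n. map_poly cnj (p n))"
  have adj: "adjoint_pair (poly_op S (p n)) (poly_op S (p' n))" for n
    unfolding p'_def by (rule adjoint_pair_poly_op[OF S])
  have "Cauchy (\<lambda>n. poly_op S (p' n))"
  proof (rule metric_CauchyI)
    fix e :: real assume "e > 0"
    have adj_diff: "adjoint_pair (poly_op S (p i) - poly_op S (p j))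
        (poly_op S (p' i) - poly_op S (p' j))" for i j
      using adj by (simp add: adjoint_pair_def blinfun.diff_left cinner_diff_left cinner_diff_right)
    have "dist (poly_op S (p' i)) (poly_op S (p' j)) = dist (poly_op S (p i)) (poly_op S (p j))"
      for i j
      unfolding dist_norm by (rule norm_adjoint_eq[OF adj_diff])
    then show "\<exists>M. \<forall>i\<ge>M. \<forall>j\<ge>M. dist (poly_op S (p' i)) (poly_op S (p' j)) < e"
      using metric_CauchyD[OF LIMSEQ_imp_Cauchy[OF p(2)] \<open>e > 0\<close>] by simp
  qed
  then obtain C where C: "(\<lambda>n. poly_op S (p' n)) \<longlonglongrightarrow> C"
    using Cauchy_convergent_iff convergent_def by blast
  have "poly (p' n) z = cnj (poly (p n) z)" if "z \<in> spectrum S" for n z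
    using spectrum_self_adjoint_real[OF S that] by (simp add: p'_def Reals_cnj_iff)
  moreover have "uniform_limit (spectrum S) (\<lambda>n z. cnj (poly (p n) z)) (\<lambda>z. cnj (f z)) sequentially"
    by (rule bounded_linear.uniform_limit[OF bounded_linear_cnj p(1)])
  ultimately have "uniform_limit (spectrum S) (\<lambda>n. poly (p' n)) (\<lambda>z. cnj (f z)) sequentially"
    by (subst uniform_limit_cong'[where g = "\<lambda>n z. cnj (poly (p n) z)" and i = "\<lambda>z. cnj (f z)"]) auto
  moreover have "adjoint_pair B C"
    unfolding adjoint_pair_def
  proof (intro allI)
    fix x y
    have "(\<lambda>n. cinner (poly_op S (p n) x) y) \<longlonglongrightarrow> cinner (B x) y"
      by (intro tendsto_cinner blinfun.tendsto p(2) tendsto_const)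
    moreover have "(\<lambda>n. cinner x (poly_op S (p' n) y)) \<longlonglongrightarrow> cinner x (C y)"
      by (intro tendsto_cinner blinfun.tendsto C tendsto_const)
    ultimately show "cinner (B x) y = cinner x (C y)"
      using LIMSEQ_unique adjoint_pairD[OF adj] by simp
  qed
  ultimately show ?thesis
    using C unfolding cfc_graph_def by blast
qed

lemma cfc_graph_norm_le:
  assumes "cfc_graph S f B" and M: "M \<ge> 0" "\<And>z. z \<in> spectrum S \<Longrightarrow> cmod (f z) \<le> M"
  shows "norm B \<le> M"
proof (rule field_le_epsilon)
  fix e :: real assume "e > 0"
  obtain p where p: "uniform_limit (spectrum S) (\<lambda>n. poly (p n)) f sequentially"
    "(\<lambda>n. poly_op S (p n)) \<longlonglongrightarrow> B"
    using assms(1) unfolding cfc_graph_def by blast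
  have "\<forall>\<^sub>F n in sequentially. norm (poly_op S (p n)) \<le> M + e"
    using uniform_limitD[OF p(1) \<open>e > 0\<close>]
  proof eventually_elim
    case (elim n)
    show ?case
    proof (rule norm_poly_op_le[OF S])
      fix z assume z: "z \<in> spectrum S"
      have "cmod (poly (p n) z) \<le> cmod (f z) + cmod (poly (p n) z - f z)"
        using norm_triangle_sub by blast
      then show "cmod (poly (p n) z) \<le> M + e"
        using elim[rule_format, OF z] M(2)[OF z] by (simp add: dist_norm)
    qed (use M(1) \<open>e > 0\<close> in simp)
  qed
  then show "norm B \<le> M + e"
    using tendsto_upperbound[OF tendsto_norm[OF p(2)]] by simp
qed

lemma cfc_graph_unique:
  assumes "cfc_graph S f B" "cfc_graph S g C" "continuous_on (spectrum S) g"
    and eq: "\<And>z. z \<in> spectrum S \<Longrightarrow> f z = g z"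
  shows "B = C"
proof -
  have "cfc_graph S (\<lambda>z. f z + (-1) * g z) (B + (cscale (-1) o\<^sub>L C))"
    by (intro cfc_graph_add cfc_graph_cscale assms)
  then have "norm (B + (cscale (-1) o\<^sub>L C)) \<le> 0"
    by (rule cfc_graph_norm_le) (simp_all add: eq)
  then have "B x + (-1) *\<^sub>C C x = 0" for x
    by (metis blinfun.add_left blinfun.zero_left blinfun_apply_blinfun_compose cscale_apply
        norm_le_zero_iff)
  then show ?thesis
    by (intro blinfun_eqI) (simp add: scaleC_minus_one)
qed

text \<open>
  Polynomials that converge uniformly on the spectrum are uniformly Cauchy there, and then
  \<open>norm_poly_op_le\<close> makes the operators a Cauchy sequence.
\<close>

lemma cfc_graph_exists:
  assumes f: "continuous_on (spectrum S) f"
  shows "\<exists>B. cfc_graph S f B"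
proof -
  have "\<exists>p. \<forall>z\<in>spectrum S. cmod (f z - poly p z) < 1 / real (Suc n)" for n
    using compact_spectrum[OF S] spectrum_self_adjoint_real[OF S] f
    by (intro Weierstrass_complex_poly) auto
  then obtain p where p: "\<And>n z. z \<in> spectrum S \<Longrightarrow> cmod (f z - poly (p n) z) < 1 / real (Suc n)"
    by metis
  have lim: "uniform_limit (spectrum S) (\<lambda>n. poly (p n)) f sequentially"
  proof (rule uniform_limitI)
    fix e :: real assume "e > 0"
    then obtain N where N: "1 / real (Suc N) < e"
      using nat_approx_posE by blast
    have "\<forall>z\<in>spectrum S. dist (poly (p n) z) (f z) < e" if "n \<ge> N" for n
    proof
      fix z assume "z \<in> spectrum S"
      then have "cmod (f z - poly (p n) z) < 1 / real (Suc n)" by (rule p)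
      also have "\<dots> \<le> 1 / real (Suc N)"
        using that by (auto simp: field_simps)
      finally show "dist (poly (p n) z) (f z) < e"
        using N by (simp add: dist_norm norm_minus_commute)
    qed
    then show "\<forall>\<^sub>F n in sequentially. \<forall>z\<in>spectrum S. dist (poly (p n) z) (f z) < e"
      by (auto simp: eventually_sequentially)
  qed
  have "Cauchy (\<lambda>n. poly_op S (p n))"
  proof (rule metric_CauchyI)
    fix e :: real assume "e > 0"
    have "uniformly_Cauchy_on (spectrum S) (\<lambda>n. poly (p n))"
      using lim by (intro uniformly_convergent_Cauchy) (auto simp: uniformly_convergent_on_def)
    then obtain M where M: "\<And>z i j. z \<in> spectrum S \<Longrightarrow> i \<ge> M \<Longrightarrow> j \<ge> M \<Longrightarrow>
        dist (poly (p i) z) (poly (p j) z) < e / 2"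
      using \<open>e > 0\<close> unfolding uniformly_Cauchy_on_def by (metis half_gt_zero)
    have "dist (poly_op S (p i)) (poly_op S (p j)) < e" if "i \<ge> M" "j \<ge> M" for i j
    proof -
      have "poly_op S (p i) = poly_op S (p i - p j) + poly_op S (p j)"
        by (simp flip: poly_op_add)
      then have "dist (poly_op S (p i)) (poly_op S (p j)) = norm (poly_op S (p i - p j))"
        by (simp add: dist_norm)
      also have "\<dots> \<le> e / 2"
        using M[OF _ that] \<open>e > 0\<close>
        by (intro norm_poly_op_le[OF S]) (auto simp: dist_norm less_imp_le)
      finally show ?thesis
        using \<open>e > 0\<close> by simp
    qed
    then show "\<exists>M. \<forall>i\<ge>M. \<forall>j\<ge>M. dist (poly_op S (p i)) (poly_op S (p j)) < e" by blast
  qed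
  then show ?thesis
    using lim Cauchy_convergent_iff convergent_def unfolding cfc_graph_def by blast
qed

text \<open>
  On continuous functions every functional calculus agrees with \<open>cfc_graph\<close>: it maps each
  polynomial \<open>p\<close> to \<open>p(S)\<close>, and it is contractive.
\<close>

lemma is_cfc_imp_cfc_graph:
  assumes \<Phi>: "is_cfc S \<Phi>" and f: "continuous_on (spectrum S) f"
  shows "cfc_graph S f (\<Phi> f)"
proof -
  have one: "\<Phi> (\<lambda>z. 1) = id_blinfun" and ident: "\<Phi> (\<lambda>z. z) = S"
    and scale: "\<And>f c x. continuous_on (spectrum S) f \<Longrightarrow> \<Phi> (\<lambda>z. c * f z) x = c *\<^sub>C \<Phi> f x"
    and contr: "\<And>f M. continuous_on (spectrum S) f \<Longrightarrow> M \<ge> 0 \<Longrightarrow>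
        \<forall>z\<in>spectrum S. cmod (f z) \<le> M \<Longrightarrow> norm (\<Phi> f) \<le> M"
    and add: "\<And>f g. continuous_on (spectrum S) f \<Longrightarrow> continuous_on (spectrum S) g \<Longrightarrow>
        \<Phi> (\<lambda>z. f z + g z) = \<Phi> f + \<Phi> g"
    and mult: "\<And>f g. continuous_on (spectrum S) f \<Longrightarrow> continuous_on (spectrum S) g \<Longrightarrow>
        \<Phi> (\<lambda>z. f z * g z) = \<Phi> f o\<^sub>L \<Phi> g"
    using \<Phi> unfolding is_cfc_def by blast+
  have cont: "continuous_on (spectrum S) (poly p)" for p :: "complex poly"
    by (intro continuous_intros)
  have poly: "\<Phi> (poly p) = poly_op S p" for p
  proof (induction p)
    case 0
    show ?case
      using scale[of "\<lambda>z. 1" 0] by (intro blinfun_eqI) (simp flip: one add: poly_0[abs_def])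
  next
    case (pCons a p)
    have "\<Phi> (\<lambda>z. a * 1) = cscale a"
      by (rule blinfun_eqI) (simp only: scale[OF continuous_on_const] one, simp)
    moreover have "\<Phi> (\<lambda>z. z * poly p z) = S o\<^sub>L poly_op S p"
      by (simp add: mult cont ident pCons.IH continuous_on_id)
    moreover have "\<Phi> (\<lambda>z. a * 1 + z * poly p z) = \<Phi> (\<lambda>z. a * 1) + \<Phi> (\<lambda>z. z * poly p z)"
      by (intro add continuous_intros)
    moreover have "poly (pCons a p) = (\<lambda>z. a * 1 + z * poly p z)"
      by (simp add: fun_eq_iff)
    ultimately show ?case by simp
  qed
  obtain B where B: "cfc_graph S f B"
    using cfc_graph_exists[OF f] by blast
  then obtain p where p: "uniform_limit (spectrum S) (\<lambda>n. poly (p n)) f sequentially"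
    "(\<lambda>n. poly_op S (p n)) \<longlonglongrightarrow> B"
    unfolding cfc_graph_def by blast
  have "(\<lambda>n. poly_op S (p n)) \<longlonglongrightarrow> \<Phi> f"
  proof (rule tendstoI)
    fix e :: real assume "e > 0"
    then have "e / 2 > 0" by simp
    show "\<forall>\<^sub>F n in sequentially. dist (poly_op S (p n)) (\<Phi> f) < e"
      using uniform_limitD[OF p(1) \<open>e / 2 > 0\<close>]
    proof eventually_elim
      case (elim n)
      define g where "g = (\<lambda>z. poly (p n) z + (-1) * f z)"
      have g: "continuous_on (spectrum S) g"
        unfolding g_def by (intro continuous_intros f)
      have "poly (p n) = (\<lambda>z. f z + g z)"
        by (simp add: g_def fun_eq_iff)
      then have "poly_op S (p n) = \<Phi> f + \<Phi> g"
        by (metis add f g poly)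
      moreover have "norm (\<Phi> g) \<le> e / 2"
        using elim \<open>e > 0\<close> by (intro contr[OF g]) (auto simp: g_def dist_norm less_imp_le)
      ultimately show ?case
        using \<open>e > 0\<close> by (simp add: dist_norm)
    qed
  qed
  then show ?thesis
    using p(1) unfolding cfc_graph_def by blast
qed

lemma is_cfc_if_cfc_graph:
  assumes graph: "\<And>f. continuous_on (spectrum S) f \<Longrightarrow> cfc_graph S f (\<Phi> f)"
  shows "is_cfc S \<Phi>"
proof -
  have eqI: "\<Phi> f = B" if "continuous_on (spectrum S) f" "cfc_graph S f B" for f B
    by (rule cfc_graph_unique[OF graph[OF that(1)] that(2,1)]) simp
  have adj: "adjoint_pair (\<Phi> f) (\<Phi> (\<lambda>z. cnj (f z)))" if "continuous_on (spectrum S) f" for f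
    using cfc_graph_cnj[OF graph[OF that]] eqI continuous_on_cnj[OF that] by metis
  show ?thesis
    unfolding is_cfc_def
  proof (intro conjI allI impI)
    have "poly_op S 1 = id_blinfun" "poly_op S [:0, 1:] = S"
      by (auto intro!: blinfun_eqI simp: one_pCons scaleC_one blinfun.add_left)
    moreover have "poly 1 = (\<lambda>z. 1 :: complex)" "poly [:0, 1:] = (\<lambda>z. z :: complex)"
      by (simp_all add: fun_eq_iff)
    ultimately have "cfc_graph S (\<lambda>z. 1) id_blinfun" "cfc_graph S (\<lambda>z. z) S"
      using cfc_graph_poly[of S 1] cfc_graph_poly[of S "[:0, 1:]"] by simp_all
    then show "\<Phi> (\<lambda>z. 1) = id_blinfun" "\<Phi> (\<lambda>z. z) = S"
      by (auto intro!: eqI continuous_intros)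
  next
    fix f :: "complex \<Rightarrow> complex" assume f: "continuous_on (spectrum S) f"
    show "\<Phi> f \<in> bounded_ops" "\<Phi> (\<lambda>z. cnj (f z)) = cadjoint (\<Phi> f)"
      using adj[OF f] by (auto simp: cadjoint_eq intro: adjoint_pair_imp_bounded_ops)
    show "\<Phi> (\<lambda>z. c * f z) x = c *\<^sub>C \<Phi> f x" for c x
      using eqI[OF _ cfc_graph_cscale[OF graph[OF f] f, of c]] f by (simp add: continuous_intros)
    show "norm (\<Phi> f) \<le> M" if "0 \<le> M" "\<forall>z\<in>spectrum S. cmod (f z) \<le> M" for M
      using that by (intro cfc_graph_norm_le[OF graph[OF f]]) auto
  next
    fix f g :: "complex \<Rightarrow> complex"
    assume "continuous_on (spectrum S) f \<and> continuous_on (spectrum S) g"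
    then show "\<Phi> (\<lambda>z. f z + g z) = \<Phi> f + \<Phi> g" "\<Phi> (\<lambda>z. f z * g z) = \<Phi> f o\<^sub>L \<Phi> g"
      by (auto intro!: eqI cfc_graph_add cfc_graph_mult graph continuous_intros)
  qed
qed

theorem is_cfc_cfc: "is_cfc S (cfc S)"
proof (rule is_cfc_if_cfc_graph)
  define \<Phi> where "\<Phi> = (\<lambda>f. SOME B. cfc_graph S f B)"
  have graph: "cfc_graph S f (\<Phi> f)" if "continuous_on (spectrum S) f" for f
    unfolding \<Phi>_def using cfc_graph_exists[OF that] by (rule someI_ex)
  fix f :: "complex \<Rightarrow> complex" assume f: "continuous_on (spectrum S) f"
  have "cfc S f = \<Phi> f"
    unfolding cfc_def
  proof (rule the_equality)
    show "\<exists>\<Psi>. is_cfc S \<Psi> \<and> \<Phi> f = \<Psi> f"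
      using is_cfc_if_cfc_graph[OF graph] by blast
    show "B = \<Phi> f" if "\<exists>\<Psi>. is_cfc S \<Psi> \<and> B = \<Psi> f" for B
      using that cfc_graph_unique[OF is_cfc_imp_cfc_graph[OF _ f] graph[OF f] f] by blast
  qed
  then show "cfc_graph S f (cfc S f)"
    using graph[OF f] by simp
qed

lemma cfc_cong:
  assumes f: "continuous_on (spectrum S) f" and eq: "\<And>z. z \<in> spectrum S \<Longrightarrow> f z = g z"
  shows "cfc S f = cfc S g"
proof -
  have g: "continuous_on (spectrum S) g"
    using f eq continuous_on_cong[of "spectrum S" "spectrum S" f g] by blast
  show ?thesis
    using cfc_graph_unique[OF is_cfc_imp_cfc_graph[OF is_cfc_cfc f]
        is_cfc_imp_cfc_graph[OF is_cfc_cfc g] g eq] .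
qed

lemma cfc_ident: "cfc S (\<lambda>z. z) = S"
  using is_cfc_cfc by (simp add: is_cfc_def)

lemma cfc_mult:
  assumes "continuous_on (spectrum S) f" "continuous_on (spectrum S) g"
  shows "cfc S (\<lambda>z. f z * g z) = cfc S f o\<^sub>L cfc S g"
  using is_cfc_cfc assms unfolding is_cfc_def by blast

lemma norm_cfc_le:
  assumes "continuous_on (spectrum S) f" "M \<ge> 0" "\<And>z. z \<in> spectrum S \<Longrightarrow> cmod (f z) \<le> M"
  shows "norm (cfc S f) \<le> M"
  using is_cfc_cfc assms unfolding is_cfc_def by blast

lemma adjoint_pair_cfc_real:
  assumes f: "continuous_on (spectrum S) f" and real: "\<And>z. cnj (f z) = f z"
  shows "adjoint_pair (cfc S f) (cfc S f)"
proof -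
  have bop: "cfc S f \<in> bounded_ops" and adj: "cfc S (\<lambda>z. cnj (f z)) = cadjoint (cfc S f)"
    using is_cfc_cfc f unfolding is_cfc_def by blast+
  show ?thesis
    using adjoint_pair_cadjoint[OF bop] unfolding adj[symmetric] real .
qed

end

section \<open>Real powers of positive operators\<close>

definition positive_op :: "('a::chilbert_space \<Rightarrow>\<^sub>L 'a) \<Rightarrow> bool" where
  "positive_op S \<longleftrightarrow> adjoint_pair S S \<and> (\<forall>x. inner (S x) x \<ge> 0)"

lemma positive_op_adjoint_compose: "adjoint_pair B C \<Longrightarrow> positive_op (C o\<^sub>L B)"
  using adjoint_pair_compose[OF adjoint_pair_sym, of B C B C]
    adjoint_pair_innerD[OF adjoint_pair_sym, of B C]
  by (simp add: positive_op_def)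

context
  fixes P :: "'a::chilbert_space \<Rightarrow>\<^sub>L 'a"
  assumes P: "positive_op P"
begin

lemma positive_op_self_adjoint: "adjoint_pair P P"
  using P by (simp add: positive_op_def)

lemma spectrum_positive_op:
  assumes "z \<in> spectrum P"
  shows "z = complex_of_real (Re z)" "0 \<le> Re z" "Re z \<le> norm P"
  using spectrum_self_adjoint_real[OF positive_op_self_adjoint assms]
    spectrum_positive_nonneg[OF positive_op_self_adjoint _ assms]
    spectrum_cmod_le[OF positive_op_self_adjoint assms] complex_Re_le_cmod[of z] P
  by (auto simp: positive_op_def)

lemma continuous_on_spectrum_powr:
  "s > 0 \<Longrightarrow> continuous_on (spectrum P) (\<lambda>z. complex_of_real (Re z powr s))"
  using spectrum_positive_op
  by (intro continuous_on_of_real continuous_on_powr' continuous_intros) auto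

lemma op_powr_add:
  "s > 0 \<Longrightarrow> t > 0 \<Longrightarrow> op_powr P (s + t) = op_powr P s o\<^sub>L op_powr P t"
  unfolding op_powr_def powr_add of_real_mult
  by (rule cfc_mult[OF positive_op_self_adjoint]) (rule continuous_on_spectrum_powr; assumption)+

lemma op_powr_one: "op_powr P 1 = P"
proof -
  have "op_powr P 1 = cfc P (\<lambda>z. z)"
    unfolding op_powr_def
    by (rule cfc_cong[OF positive_op_self_adjoint continuous_on_spectrum_powr])
      (use spectrum_positive_op in simp_all)
  then show ?thesis
    by (simp add: cfc_ident[OF positive_op_self_adjoint])
qed

lemma adjoint_pair_op_powr: "s > 0 \<Longrightarrow> adjoint_pair (op_powr P s) (op_powr P s)"
  unfolding op_powr_def
  by (rule adjoint_pair_cfc_real[OF positive_op_self_adjoint continuous_on_spectrum_powr]) simp_all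

lemma positive_op_powr:
  assumes "s > 0"
  shows "positive_op (op_powr P s)"
  using positive_op_adjoint_compose[OF adjoint_pair_op_powr, of "s / 2"] assms
    op_powr_add[of "s / 2" "s / 2"] by simp

lemma norm_op_powr_le: "s > 0 \<Longrightarrow> norm (op_powr P s) \<le> norm P powr s"
  unfolding op_powr_def
  by (rule norm_cfc_le[OF positive_op_self_adjoint continuous_on_spectrum_powr])
    (use spectrum_positive_op in \<open>auto intro!: powr_mono2\<close>)

lemma norm_op_powr_double: "s > 0 \<Longrightarrow> norm (op_powr P (2 * s)) = (norm (op_powr P s))\<^sup>2"
  using norm_adjoint_compose_self[OF adjoint_pair_op_powr, of s] op_powr_add[of s s] by simp

text \<open>
  For \<open>s = 2\<^sup>k\<close> this is the C*-identity.  In general \<open>\<parallel>P\<parallel>\<^sup>n = \<parallel>P\<^sup>n\<parallel> \<le> \<parallel>P\<^sup>s\<parallel> \<parallel>P\<parallel>\<^sup>n\<^sup>-\<^sup>s\<close> for such an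
  exponent \<open>n > s\<close>, which gives the lower bound.
\<close>

lemma norm_op_powr:
  assumes s: "s > 0"
  shows "norm (op_powr P s) = norm P powr s"
proof (cases "norm P = 0")
  case True
  then show ?thesis
    using norm_op_powr_le[OF s] by simp
next
  case False
  have pow2: "norm (op_powr P (2 ^ k)) = norm P powr (2 ^ k)" for k
  proof (induction k)
    case (Suc k)
    then show ?case
      using norm_op_powr_double[of "2 ^ k"] powr_add[of "norm P" "2 ^ k" "2 ^ k"]
      by (simp add: power2_eq_square)
  qed (use False in \<open>simp add: op_powr_one\<close>)
  obtain k where k: "s < 2 ^ k"
    using real_arch_pow[of 2 s] by auto
  define t where "t = 2 ^ k - s"
  have t: "t > 0" "s + t = 2 ^ k"
    using k by (auto simp: t_def)
  have "norm P powr s * norm P powr t = norm (op_powr P s o\<^sub>L op_powr P t)"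
    using pow2[of k] op_powr_add[OF s t(1)] by (simp add: t(2) flip: powr_add)
  also have "\<dots> \<le> norm (op_powr P s) * norm (op_powr P t)"
    by (rule norm_blinfun_compose)
  also have "\<dots> \<le> norm (op_powr P s) * norm P powr t"
    by (intro mult_left_mono norm_op_powr_le t(1) norm_ge_zero)
  finally have "norm P powr s \<le> norm (op_powr P s)"
    using False by simp
  then show ?thesis
    using norm_op_powr_le[OF s] by simp
qed

end

lemma
  assumes "adjoint_pair A A'"
  shows positive_op_abs: "positive_op (op_abs A)" and norm_op_abs: "norm (op_abs A) = norm A"
proof -
  have N: "positive_op (A' o\<^sub>L A)"
    by (rule positive_op_adjoint_compose[OF assms])
  have abs: "op_abs A = op_powr (A' o\<^sub>L A) (1/2)"
    by (simp add: op_abs_def cadjoint_eq[OF assms])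
  show "positive_op (op_abs A)"
    unfolding abs by (rule positive_op_powr[OF N]) simp
  show "norm (op_abs A) = norm A"
    unfolding abs using norm_op_powr[OF N, of "1/2"] norm_adjoint_compose_self[OF assms]
    by (simp add: powr_half_sqrt)
qed

section \<open>The numerical radius of a normal operator\<close>

lemma
  fixes S :: "'a::chilbert_space \<Rightarrow>\<^sub>L 'a"
  shows numerical_radius_nonneg: "0 \<le> numerical_radius S"
    and numerical_radius_le_norm: "numerical_radius S \<le> norm S"
    and cmod_cinner_le_numerical_radius:
      "cmod (cinner (S x) x) \<le> numerical_radius S * (norm x)\<^sup>2"
proof -
  let ?W = "insert 0 {cmod (cinner (S x) x) | x. norm x = 1}"
  have le: "w \<le> norm S" if "w \<in> ?W" for w
  proof -
    have "cmod (cinner (S x) x) \<le> norm S" if "norm x = 1" for x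
      using cmod_cinner_le[of "S x" x] norm_blinfun[of S x] that by simp
    then show ?thesis using that by auto
  qed
  have bdd: "bdd_above ?W"
    using le by (rule bdd_aboveI)
  show "0 \<le> numerical_radius S"
    unfolding numerical_radius_def by (rule cSup_upper[OF _ bdd]) simp
  show "numerical_radius S \<le> norm S"
    unfolding numerical_radius_def by (rule cSup_least) (use le in auto)
  show "cmod (cinner (S x) x) \<le> numerical_radius S * (norm x)\<^sup>2"
  proof (cases "x = 0")
    case False
    define u where "u = (1 / norm x) *\<^sub>R x"
    have x: "x = norm x *\<^sub>R u" and u: "norm u = 1"
      using False by (simp_all add: u_def)
    have "cmod (cinner (S u) u) \<le> numerical_radius S"
      unfolding numerical_radius_def by (rule cSup_upper[OF _ bdd]) (use u in blast)
    moreover have "cinner (S x) x = complex_of_real ((norm x)\<^sup>2) * cinner (S u) u"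
      by (subst (1 2) x, subst blinfun.scaleR_right)
        (simp only: scaleR_scaleC cinner_scaleC_left cinner_scaleC_right complex_cnj_complex_of_real
          power2_eq_square of_real_mult mult.assoc)
    ultimately show ?thesis
      by (simp add: norm_mult mult_left_mono mult.commute[of "numerical_radius S"] del: of_real_power)
  qed simp
qed

text \<open>
  Polarization with the four vectors \<open>x \<plusminus> y\<close>, \<open>x \<plusminus> \<i> y\<close> bounds the whole sesquilinear form.
\<close>

lemma norm_le_twice_numerical_bound:
  fixes A :: "'a::chilbert_space \<Rightarrow>\<^sub>L 'a"
  assumes A: "A \<in> bounded_ops" and w: "\<And>x. cmod (cinner (A x) x) \<le> w * (norm x)\<^sup>2" "0 \<le> w"
  shows "norm A \<le> 2 * w"
proof -
  have sym: "cmod (cinner (A x) y + cinner (A y) x) \<le> w * ((norm x)\<^sup>2 + (norm y)\<^sup>2)" for x y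
  proof -
    have "2 * (cinner (A x) y + cinner (A y) x)
        = cinner (A (x + y)) (x + y) - cinner (A (x - y)) (x - y)"
      by (simp add: blinfun.add_right blinfun.diff_right cinner_add_left cinner_add_right
          cinner_diff_left cinner_diff_right)
    then have "2 * cmod (cinner (A x) y + cinner (A y) x)
        = cmod (cinner (A (x + y)) (x + y) - cinner (A (x - y)) (x - y))"
      by (metis norm_mult norm_numeral)
    also have "\<dots> \<le> w * (norm (x + y))\<^sup>2 + w * (norm (x - y))\<^sup>2"
      by (rule order_trans[OF norm_triangle_ineq4 add_mono[OF w(1) w(1)]])
    also have "\<dots> = 2 * (w * ((norm x)\<^sup>2 + (norm y)\<^sup>2))"
      unfolding power2_norm_eq_inner by (simp add: inner_simps inner_commute algebra_simps)
    finally show ?thesis by simp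
  qed
  have form: "cmod (cinner (A x) y) \<le> w * ((norm x)\<^sup>2 + (norm y)\<^sup>2)" for x y
  proof -
    have "A (\<i> *\<^sub>C y) = \<i> *\<^sub>C A y"
      using A by (simp add: bounded_ops_def)
    then have "2 * cinner (A x) y = (cinner (A x) y + cinner (A y) x)
        + \<i> * (cinner (A x) (\<i> *\<^sub>C y) + cinner (A (\<i> *\<^sub>C y)) x)"
      by (simp add: cinner_scaleC_left cinner_scaleC_right distrib_left
          right_diff_distrib flip: mult.assoc)
    then have "2 * cmod (cinner (A x) y) = cmod ((cinner (A x) y + cinner (A y) x)
        + \<i> * (cinner (A x) (\<i> *\<^sub>C y) + cinner (A (\<i> *\<^sub>C y)) x))"
      by (metis norm_mult norm_numeral)
    also have "\<dots> \<le> cmod (cinner (A x) y + cinner (A y) x)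
        + cmod (cinner (A x) (\<i> *\<^sub>C y) + cinner (A (\<i> *\<^sub>C y)) x)"
      by (rule order_trans[OF norm_triangle_ineq]) (simp add: norm_mult)
    also have "\<dots> \<le> w * ((norm x)\<^sup>2 + (norm y)\<^sup>2) + w * ((norm x)\<^sup>2 + (norm y)\<^sup>2)"
      using sym[of x y] sym[of x "\<i> *\<^sub>C y"] by (simp add: norm_scaleC)
    finally show ?thesis by simp
  qed
  show ?thesis
  proof (rule norm_blinfun_bound)
    fix x
    show "norm (A x) \<le> 2 * w * norm x"
    proof (cases "x = 0 \<or> A x = 0")
      case False
      \<comment> \<open>With this \<open>t\<close> the vector \<open>t A x\<close> has the norm of \<open>x\<close>, which makes the bound optimal.\<close>
      define t where "t = norm x / norm (A x)"
      have "norm x * norm (A x) = cmod (cinner (A x) (t *\<^sub>R A x))"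
        using False by (simp add: scaleR_scaleC cinner_scaleC_right cinner_self norm_mult t_def
            power2_eq_square flip: of_real_power)
      also have "\<dots> \<le> w * ((norm x)\<^sup>2 + (norm (t *\<^sub>R A x))\<^sup>2)"
        by (rule form)
      also have "norm (t *\<^sub>R A x) = norm x"
        using False by (simp add: t_def)
      finally have "norm x * norm (A x) \<le> norm x * (2 * w * norm x)"
        by (simp add: power2_eq_square algebra_simps)
      then show ?thesis
        using False by simp
    qed (use w(2) in auto)
  qed (use w(2) in simp)
qed

text \<open>
  The case \<open>n = 2\<close> of the power inequality \<open>w(A\<^sup>n) \<le> w(A)\<^sup>n\<close>, by Pearcy's argument: put
  \<open>u = (x + A x / w) / 2\<close> and \<open>v = (x - A x / w) / 2\<close>, so that \<open>x = u + v\<close>; then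
  \<open>w\<^sup>2 x - A\<^sup>2 x\<close> equals both \<open>2 w (w u - A u)\<close> and \<open>2 w (w v + A v)\<close>.
\<close>

lemma inner_square_le:
  fixes A :: "'a::real_inner \<Rightarrow>\<^sub>L 'a"
  assumes w: "w > 0" and le: "\<And>x. \<bar>inner (A x) x\<bar> \<le> w * (norm x)\<^sup>2"
  shows "inner (A (A x)) x \<le> w\<^sup>2 * (norm x)\<^sup>2"
proof -
  define u where "u = (1/2) *\<^sub>R (x + (1 / w) *\<^sub>R A x)"
  define v where "v = (1/2) *\<^sub>R (x - (1 / w) *\<^sub>R A x)"
  define y where "y = w\<^sup>2 *\<^sub>R x - A (A x)"
  have half: "(1/2) *\<^sub>R z + (1/2) *\<^sub>R z = z" for z :: 'a
    by (simp flip: scaleR_left_distrib)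
  have x: "x = u + v"
    unfolding u_def v_def scaleR_right_distrib scaleR_right_diff_distrib by (simp add: half)
  have yu: "y = (2 * w) *\<^sub>R (w *\<^sub>R u - A u)" and yv: "y = (2 * w) *\<^sub>R (w *\<^sub>R v + A v)"
    using w by (simp_all add: y_def u_def v_def blinfun.bilinear_simps scaleR_right_distrib
        scaleR_right_diff_distrib power2_eq_square)
  have "inner y x = inner y u + inner y v"
    unfolding x by (rule inner_add_right)
  also have "inner y u = 2 * w * (w * (norm u)\<^sup>2 - inner (A u) u)"
    unfolding yu power2_norm_eq_inner by (simp add: inner_simps)
  also have "inner y v = 2 * w * (w * (norm v)\<^sup>2 + inner (A v) v)"
    unfolding yv power2_norm_eq_inner by (simp add: inner_simps)
  also have "2 * w * (w * (norm u)\<^sup>2 - inner (A u) u) + 2 * w * (w * (norm v)\<^sup>2 + inner (A v) v) \<ge> 0"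
  proof -
    have "w * (norm u)\<^sup>2 - inner (A u) u \<ge> 0" "w * (norm v)\<^sup>2 + inner (A v) v \<ge> 0"
      using le[of u] le[of v] by linarith+
    then show ?thesis
      using w by simp
  qed
  finally show ?thesis
    unfolding y_def power2_norm_eq_inner by (simp add: inner_simps)
qed

text \<open>
  The real inequality bounds \<open>Re \<langle>A\<^sup>2 x, x\<rangle>\<close>.  To reach the modulus, \<open>A\<close> is multiplied by a square
  root of the unimodular number \<open>c\<close> that rotates \<open>\<langle>A\<^sup>2 x, x\<rangle>\<close> to its modulus.
\<close>

lemma numerical_bound_square:
  fixes A :: "'a::chilbert_space \<Rightarrow>\<^sub>L 'a"
  assumes A: "A \<in> bounded_ops" and w: "w > 0" "\<And>x. cmod (cinner (A x) x) \<le> w * (norm x)\<^sup>2"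
  shows "cmod (cinner ((A o\<^sub>L A) x) x) \<le> w\<^sup>2 * (norm x)\<^sup>2"
proof -
  obtain c where c: "cmod c = 1"
    "c * cinner (A (A x)) x = complex_of_real (cmod (cinner (A (A x)) x))"
    by (rule unimodular_rotation)
  define d where "d = csqrt c"
  have d: "cmod d = 1" "d * d = c"
    using c(1) power2_csqrt[of c] by (auto simp: d_def power2_eq_square)
  define B where "B = cscale d o\<^sub>L A"
  have "\<bar>inner (B z) z\<bar> \<le> w * (norm z)\<^sup>2" for z
  proof -
    have "\<bar>inner (B z) z\<bar> \<le> cmod (cinner (B z) z)"
      unfolding inner_eq_Re_cinner by (rule abs_Re_le_cmod)
    then show ?thesis
      using w(2)[of z] by (simp add: B_def cinner_scaleC_left norm_mult d)
  qed
  then have "inner (B (B x)) x \<le> w\<^sup>2 * (norm x)\<^sup>2"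
    by (rule inner_square_le[OF w(1)])
  moreover have "B (B x) = c *\<^sub>C A (A x)"
    using A by (simp add: B_def bounded_ops_def scaleC_scaleC d)
  ultimately show ?thesis
    by (simp add: inner_eq_Re_cinner cinner_scaleC_left c(2))
qed

text \<open>
  The C*-identity for \<open>A\<^sup>2\<close>, for the self-adjoint \<open>A\<^sup>* A\<close> and for \<open>A\<close> gives
  \<open>\<parallel>A\<^sup>2\<parallel>\<^sup>2 = \<parallel>(A\<^sup>* A)\<^sup>2\<parallel> = \<parallel>A\<^sup>* A\<parallel>\<^sup>2 = \<parallel>A\<parallel>\<^sup>4\<close>.
\<close>

lemma norm_normal_square:
  assumes adj: "adjoint_pair A A'" and comm: "A o\<^sub>L A' = A' o\<^sub>L A"
  shows "norm (A o\<^sub>L A) = (norm A)\<^sup>2"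
proof -
  have comm_apply: "A (A' x) = A' (A x)" for x
    by (metis blinfun_apply_blinfun_compose comm)
  have "(norm (A o\<^sub>L A))\<^sup>2 = norm ((A' o\<^sub>L A') o\<^sub>L (A o\<^sub>L A))"
    by (rule norm_adjoint_compose_self[symmetric, OF adjoint_pair_compose[OF adj adj]])
  also have "(A' o\<^sub>L A') o\<^sub>L (A o\<^sub>L A) = (A' o\<^sub>L A) o\<^sub>L (A' o\<^sub>L A)"
    by (rule blinfun_eqI) (simp add: comm_apply)
  also have "norm \<dots> = (norm (A' o\<^sub>L A))\<^sup>2"
    by (rule norm_adjoint_compose_self) (rule adjoint_pair_compose[OF adjoint_pair_sym[OF adj] adj])
  also have "norm (A' o\<^sub>L A) = (norm A)\<^sup>2"
    by (rule norm_adjoint_compose_self[OF adj])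
  finally show ?thesis
    by (rule power2_eq_imp_eq) simp_all
qed

text \<open>
  Each step replaces \<open>A\<close> and \<open>w\<close> by their squares; the constant \<open>2\<close> is incurred once only, at the
  end.
\<close>

lemma norm_normal_power_le:
  assumes "adjoint_pair A A'" "A o\<^sub>L A' = A' o\<^sub>L A"
    and "w > 0" "\<And>x. cmod (cinner (A x) x) \<le> w * (norm x)\<^sup>2"
  shows "norm A ^ (2 ^ k) \<le> 2 * w ^ (2 ^ k)"
  using assms
proof (induction k arbitrary: A A' w)
  case 0
  then show ?case
    using norm_le_twice_numerical_bound[of A w] adjoint_pair_imp_bounded_ops by fastforce
next
  case (Suc k)
  have "norm (A o\<^sub>L A) ^ (2 ^ k) \<le> 2 * (w\<^sup>2) ^ (2 ^ k)"
  proof (rule Suc.IH)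
    show "adjoint_pair (A o\<^sub>L A) (A' o\<^sub>L A')"
      by (intro adjoint_pair_compose Suc.prems)
    show "(A o\<^sub>L A) o\<^sub>L (A' o\<^sub>L A') = (A' o\<^sub>L A') o\<^sub>L (A o\<^sub>L A)"
    proof (rule blinfun_eqI)
      have "A (A' x) = A' (A x)" for x
        by (metis blinfun_apply_blinfun_compose Suc.prems(2))
      then show "((A o\<^sub>L A) o\<^sub>L (A' o\<^sub>L A')) x = ((A' o\<^sub>L A') o\<^sub>L (A o\<^sub>L A)) x" for x
        by simp
    qed
    show "cmod (cinner ((A o\<^sub>L A) x) x) \<le> w\<^sup>2 * (norm x)\<^sup>2" for x
      by (rule numerical_bound_square[OF adjoint_pair_imp_bounded_ops[OF Suc.prems(1)]
            Suc.prems(3,4)])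
  qed (use Suc.prems in simp)
  then show ?case
    unfolding norm_normal_square[OF Suc.prems(1,2)] by (simp add: power_mult)
qed

theorem numerical_radius_normal:
  assumes adj: "adjoint_pair A A'" and comm: "A o\<^sub>L A' = A' o\<^sub>L A"
  shows "numerical_radius A = norm A"
proof (rule antisym[OF numerical_radius_le_norm])
  show "norm A \<le> numerical_radius A"
  proof (rule dense_ge)
    fix w assume w: "numerical_radius A < w"
    then have "w > 0"
      using numerical_radius_nonneg[of A] by simp
    have "cmod (cinner (A x) x) \<le> w * (norm x)\<^sup>2" for x
      using cmod_cinner_le_numerical_radius[of A x] w
      by (meson less_imp_le mult_right_mono order_trans zero_le_power2)
    then have le: "norm A ^ (2 ^ k) \<le> 2 * w ^ (2 ^ k)" for k
      by (rule norm_normal_power_le[OF adj comm \<open>w > 0\<close>])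
    show "norm A \<le> w"
    proof (rule ccontr)
      assume "\<not> norm A \<le> w"
      then have q: "norm A / w > 1"
        using \<open>w > 0\<close> by simp
      then obtain n where "2 < (norm A / w) ^ n"
        using real_arch_pow by blast
      also have "\<dots> \<le> (norm A / w) ^ (2 ^ n)"
        using q by (intro power_increasing) (auto intro: less_imp_le)
      also have "\<dots> \<le> 2"
        using le[of n] \<open>w > 0\<close> by (simp add: power_divide divide_le_eq)
      finally show False by simp
    qed
  qed
qed

section \<open>The block operator\<close>

lemma block_op_antidiag_apply: "block_op 0 A A 0 p = (A (snd p), A (fst p))"
  by (cases p) (simp add: block_op_apply)

lemma adjoint_pair_block_op_antidiag:
  "adjoint_pair A A' \<Longrightarrow> adjoint_pair (block_op 0 A A 0) (block_op 0 A' A' 0)"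
  by (simp add: adjoint_pair_def block_op_antidiag_apply cinner_prod_def add.commute)

lemma norm_block_op_antidiag: "norm (block_op 0 A A 0) = norm A"
proof (rule antisym)
  show "norm (block_op 0 A A 0) \<le> norm A"
  proof (rule norm_blinfun_bound)
    fix p
    have "norm (block_op 0 A A 0 p) \<le> sqrt ((norm A * norm (snd p))\<^sup>2 + (norm A * norm (fst p))\<^sup>2)"
      unfolding block_op_antidiag_apply norm_Pair
      by (intro real_sqrt_le_mono add_mono power_mono norm_blinfun) auto
    also have "\<dots> = norm A * norm p"
      by (simp add: norm_prod_def power_mult_distrib real_sqrt_mult add.commute
          flip: distrib_left)
    finally show "norm (block_op 0 A A 0 p) \<le> norm A * norm p" .
  qed simp
  show "norm A \<le> norm (block_op 0 A A 0)"
  proof (rule norm_blinfun_bound)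
    fix x
    show "norm (A x) \<le> norm (block_op 0 A A 0) * norm x"
      using norm_blinfun[of "block_op 0 A A 0" "(0, x)"]
      by (simp add: block_op_antidiag_apply norm_Pair)
  qed simp
qed

theorem proposition5p4:
  fixes A :: "'a::chilbert_space \<Rightarrow>\<^sub>L 'a" and r :: real
  assumes "A \<in> bounded_ops" and "normal_op A" and "r \<ge> 1"
  shows "numerical_radius (block_op 0 A A 0) powr (2 * r) =
           1/4 * norm (op_powr (op_abs A) (2 * r) + op_powr (op_abs (cadjoint A)) (2 * r))
           + 1/2 * numerical_radius (op_powr (op_abs A) r o\<^sub>L op_powr (op_abs (cadjoint A)) r)
       \<and> 1/4 * norm (op_powr (op_abs A) (2 * r) + op_powr (op_abs (cadjoint A)) (2 * r))
           + 1/2 * numerical_radius (op_powr (op_abs A) r o\<^sub>L op_powr (op_abs (cadjoint A)) r)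
         = norm A powr (2 * r)"
proof -
  define P where "P = op_abs A"
  have adj: "adjoint_pair A (cadjoint A)"
    by (rule adjoint_pair_cadjoint[OF assms(1)])
  have comm: "A o\<^sub>L cadjoint A = cadjoint A o\<^sub>L A"
    using assms(2) by (simp add: normal_op_def)
  have P': "op_abs (cadjoint A) = P"
    by (simp add: P_def op_abs_def cadjoint_eq[OF adjoint_pair_sym[OF adj]] comm)
  have P: "positive_op P" "norm P = norm A"
    unfolding P_def using positive_op_abs[OF adj] norm_op_abs[OF adj] by simp_all
  have r: "r > 0" "2 * r > 0"
    using assms(3) by simp_all
  have "numerical_radius (block_op 0 A A 0) = norm A"
  proof -
    have "block_op 0 A A 0 o\<^sub>L block_op 0 (cadjoint A) (cadjoint A) 0
        = block_op 0 (cadjoint A) (cadjoint A) 0 o\<^sub>L block_op 0 A A 0"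
    proof (rule blinfun_eqI)
      have "A (cadjoint A x) = cadjoint A (A x)" for x
        by (metis blinfun_apply_blinfun_compose comm)
      then show "(block_op 0 A A 0 o\<^sub>L block_op 0 (cadjoint A) (cadjoint A) 0) p
          = (block_op 0 (cadjoint A) (cadjoint A) 0 o\<^sub>L block_op 0 A A 0) p" for p
        by (simp add: block_op_antidiag_apply)
    qed
    then show ?thesis
      by (simp add: numerical_radius_normal[OF adjoint_pair_block_op_antidiag[OF adj]]
          norm_block_op_antidiag)
  qed
  moreover have "norm (op_powr P (2 * r) + op_powr P (2 * r)) = 2 * norm A powr (2 * r)"
    using norm_op_powr[OF P(1) r(2)] by (simp add: P(2) flip: scaleR_2)
  moreover have "numerical_radius (op_powr P r o\<^sub>L op_powr P r) = norm A powr (2 * r)"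
  proof -
    have "op_powr P r o\<^sub>L op_powr P r = op_powr P (2 * r)"
      using op_powr_add[OF P(1) r(1) r(1)] by simp
    then show ?thesis
      using numerical_radius_normal[OF adjoint_pair_op_powr[OF P(1) r(2)]]
        norm_op_powr[OF P(1) r(2)] by (simp add: P(2))
  qed
  ultimately show ?thesis
    unfolding P_def[symmetric] P' by simp
qed

end
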